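(* Let $A = U V^\top \in \mathbb{R}^{n \times n}$ where $U, V \in \mathbb{R}^{n \times 2}$. Then $$\frac{\operatorname{per}(A)^2}{(n!)^2} - \frac{\operatorname{per}(A \otimes J_2)}{(2n)!} = \sum_{k=1}^{\lfloor n/2 \rfloor} C_{n,k} \sum_{\substack{I, J \subseteq [n]:\\ |I| = |J| = n-2k }} \frac{\operatorname{per}(A_{I,J})^2}{((n-2k)!)^2} \cdot \Delta_{[n] \setminus I}(U)\, \Delta_{[n] \setminus J}(V),$$ where the coefficients $C_{n,k}$ for $1 \le k \le \lfloor n/2\rfloor$ are given by $$C_{n,k} = \frac{(2n-2k)!\,(2k)!\,(n-2k)!\,(n-2k+1)!}{(2n)!\,(2k-1)\,(n-k)!\,(n-k+1)!}.$$ In particular, $C_{n,k} \ge 0$ for $1 \le k \le \lfloor n/2\rfloor$, and $$\frac{\operatorname{per}(A)^2}{(n!)^2} - \frac{\operatorname{per}(A \otimes J_2)}{(2n)!}$$ equals a homogeneous sum-of-squares polynomial in (the entries of) $U$ and $V$ of degree $4n$.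
   Context: $[n]=\{1,\dots,n\}$. The permanent of $A\in\mathbb{R}^{m\times m}$ is $\operatorname{per}(A) = \sum_{\pi\in\mathcal{S}_m}\prod_{i=1}^m A_{i,\pi(i)}$ (the permanent of the empty matrix is $1$). $J_2$ is the $2\times2$ all-ones matrix, $\otimes$ is the Kronecker product, and $A_{I,J}$ is the submatrix of $A$ with rows indexed by $I$ and columns indexed by $J$. For a finite set $S$, $\mathcal{P}_2(S)$ is the set of perfect matchings of $S$ (partitions of $S$ into parts of size exactly 2). For $U\in\mathbb{R}^{n\times 2}$ with row vectors $u_1^\top,\dots,u_n^\top$, $u_i\in\mathbb{R}^2$, and $S\subseteq[n]$ of even size, $$\Delta_S(U) = \sum_{M\in\mathcal{P}_2(S)} \prod_{\{i,j\}\in M} \det\begin{pmatrix} u_i^\top\\ u_j^\top\end{pmatrix}^2,$$ with $\Delta_{\varnothing}=1$. A sum-of-squares polynomial is a finite sum of squares of polynomials with real coefficients (the zero polynomial counts as such, and as homogeneous of any degree). *)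

theory Defs
  imports
    "HOL-Library.Disjoint_Sets"
    "HOL-Library.Poly_Mapping"
    "HOL-Combinatorics.Permutations"
    "Jordan_Normal_Form.Determinant"
    "Jordan_Normal_Form.DL_Submatrix"
begin

text \<open>Rows and columns are indexed from 0, so the index set of the first n positive
  integers becomes \<open>{0..<n}\<close> throughout.\<close>

subsection \<open>Permanents and Kronecker products\<close>

text \<open>Only meant for square matrices.\<close>

definition permanent :: "'a :: comm_semiring_1 mat \<Rightarrow> 'a" where
  "permanent A = (\<Sum>p | p permutes {0..<dim_row A}. \<Prod>i = 0..<dim_row A. A $$ (i, p i))"

definition kronecker :: "'a :: semiring_1 mat \<Rightarrow> 'a mat \<Rightarrow> 'a mat" where
  "kronecker A B = mat (dim_row A * dim_row B) (dim_col A * dim_col B)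
     (\<lambda>(i, j). A $$ (i div dim_row B, j div dim_col B) * B $$ (i mod dim_row B, j mod dim_col B))"

definition all_ones_mat :: "nat \<Rightarrow> 'a :: semiring_1 mat" where
  "all_ones_mat m = mat m m (\<lambda>_. 1)"

lemma permanent_empty: "dim_row A = 0 \<Longrightarrow> permanent A = 1"
  by (simp add: permanent_def)


subsection \<open>The matching sums\<close>

definition perfect_matchings :: "'a set \<Rightarrow> 'a set set set" where
  "perfect_matchings S = {M. partition_on S M \<and> (\<forall>e\<in>M. card e = 2)}"

definition pair_det :: "'a :: comm_ring_1 mat \<Rightarrow> nat \<Rightarrow> nat \<Rightarrow> 'a" where
  "pair_det U i j = det (mat_of_rows 2 [row U i, row U j])"

text \<open>The squared determinant does not depend on the order in which the two elements of an
  unordered pair are listed; listing them as minimum and maximum is an arbitrary choice,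
  see \<open>edge_weight_doubleton\<close> below.\<close>

definition edge_weight :: "'a :: comm_ring_1 mat \<Rightarrow> nat set \<Rightarrow> 'a" where
  "edge_weight U e = (pair_det U (Min e) (Max e))\<^sup>2"

definition Delta :: "'a :: comm_ring_1 mat \<Rightarrow> nat set \<Rightarrow> 'a" where
  "Delta U S = (\<Sum>M\<in>perfect_matchings S. \<Prod>e\<in>M. edge_weight U e)"

lemma pair_det_eq:
  fixes U :: "'a :: comm_ring_1 mat"
  shows "pair_det U i j = row U i $ 0 * row U j $ 1 - row U i $ 1 * row U j $ 0"
proof -
  define B where "B = mat_of_rows 2 [row U i, row U j]"
  have B: "dim_row B = 2" "dim_col B = 2"
    by (simp_all add: B_def)
  have entries: "B $$ (0, 0) = row U i $ 0" "B $$ (0, 1) = row U i $ 1"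
    "B $$ (1, 0) = row U j $ 0" "B $$ (1, 1) = row U j $ 1"
    by (simp_all add: B_def mat_of_rows_index)
  have two: "{0..<2} = {0, 1 :: nat}"
    by auto
  have perms: "{p. p permutes {0, 1 :: nat}} = {id, Transposition.transpose 0 1}"
    by (auto simp: permutes_doubleton_iff)
  have ne: "id \<noteq> Transposition.transpose 0 (1 :: nat)"
    by (metis id_apply transpose_apply_first zero_neq_one)
  have sg: "signof (Transposition.transpose 0 (1 :: nat)) = (- 1 :: 'a)"
    by (simp add: sign_swap_id)
  have "pair_det U i j = (\<Sum>p\<in>{id, Transposition.transpose 0 1}.
      signof p * (\<Prod>k\<in>{0, 1}. B $$ (k, p k)))"
    using B unfolding pair_det_def B_def[symmetric] det_def by (simp only: two perms refl if_True)
  also have "\<dots> = row U i $ 0 * row U j $ 1 - row U i $ 1 * row U j $ 0"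
    using ne sg entries by (simp del: One_nat_def)
  finally show ?thesis .
qed

lemma pair_det_swap: "(pair_det U i j)\<^sup>2 = (pair_det U j i)\<^sup>2"
  unfolding pair_det_eq by (simp add: power2_eq_square algebra_simps)

lemma edge_weight_doubleton: "edge_weight U {i, j} = (pair_det U i j)\<^sup>2"
  using pair_det_swap[of U i j]
  by (cases "i \<le> j") (simp_all add: edge_weight_def max_def min_def)

lemma Delta_empty: "Delta U {} = 1"
proof -
  have "perfect_matchings ({} :: nat set) = {{}}"
    by (auto simp: perfect_matchings_def partition_on_def)
  then show ?thesis
    by (simp add: Delta_def)
qed


subsection \<open>The coefficients\<close>

definition coeff_C :: "nat \<Rightarrow> nat \<Rightarrow> real" where
  "coeff_C n k =
     (fact (2 * n - 2 * k) * fact (2 * k) * fact (n - 2 * k) * fact (n - 2 * k + 1)) /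
     (fact (2 * n) * (2 * real k - 1) * fact (n - k) * fact (n - k + 1))"


subsection \<open>Polynomials in the entries of two matrices\<close>

text \<open>A multivariate polynomial is a finitely supported map from monomials (finitely supported
  exponent functions) to coefficients; sum and product are those of the type of finitely
  supported maps (convolution).\<close>

type_synonym 'v mpoly = "('v \<Rightarrow>\<^sub>0 nat) \<Rightarrow>\<^sub>0 real"

definition mpoly_vars :: "'v mpoly \<Rightarrow> 'v set" where
  "mpoly_vars p = (\<Union>m\<in>Poly_Mapping.keys p. Poly_Mapping.keys m)"

definition mpoly_eval :: "('v \<Rightarrow> real) \<Rightarrow> 'v mpoly \<Rightarrow> real" where
  "mpoly_eval x p = (\<Sum>m\<in>Poly_Mapping.keys p. Poly_Mapping.lookup p m *
     (\<Prod>v\<in>Poly_Mapping.keys m. x v ^ Poly_Mapping.lookup m v))"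

text \<open>The zero polynomial is homogeneous of every degree.\<close>

definition homogeneous :: "nat \<Rightarrow> 'v mpoly \<Rightarrow> bool" where
  "homogeneous d p \<longleftrightarrow>
     (\<forall>m\<in>Poly_Mapping.keys p. (\<Sum>v\<in>Poly_Mapping.keys m. Poly_Mapping.lookup m v) = d)"

text \<open>Sums of squares inside the polynomial ring in the variables \<open>X\<close>; the empty list gives the
  zero polynomial.\<close>

definition sum_of_squares :: "'v set \<Rightarrow> 'v mpoly \<Rightarrow> bool" where
  "sum_of_squares X p \<longleftrightarrow>
     (\<exists>qs. (\<forall>q\<in>set qs. mpoly_vars q \<subseteq> X) \<and> p = (\<Sum>q\<leftarrow>qs. q\<^sup>2))"

datatype entry = U_entry nat nat | V_entry nat nat

definition entries :: "nat \<Rightarrow> entry set" where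
  "entries n = {U_entry i j | i j. i < n \<and> j < 2} \<union> {V_entry i j | i j. i < n \<and> j < 2}"

definition entry_value :: "real mat \<Rightarrow> real mat \<Rightarrow> entry \<Rightarrow> real" where
  "entry_value U V v = (case v of U_entry i j \<Rightarrow> U $$ (i, j) | V_entry i j \<Rightarrow> V $$ (i, j))"

end

theory Submission
  imports Defs
begin

text \<open>
  Both permanents are symmetric in the rows of \<open>U\<close> and depend on each row \<open>u\<close> only through the
  quadratic tensor \<open>u u\<^sup>T\<close>, linearly; the same holds for \<open>V\<close>. By polarization such functions are
  determined by the polynomials obtained on replacing every \<open>u u\<^sup>T\<close> by
  \<open>Q = \<Sum>\<^bsub>s\<in>S\<^esub> u\<^sub>s u\<^sub>s\<^sup>T\<close> and every \<open>v v\<^sup>T\<close> by \<open>R = \<Sum>\<^bsub>t\<in>T\<^esub> v\<^sub>t v\<^sub>t\<^sup>T\<close>, for all sets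
  of indices \<open>S\<close> and \<open>T\<close>. With \<open>x\<close> and \<open>y\<close> the eigenvalues of \<open>Q R\<close>, the squared permanent
  becomes the complete homogeneous polynomial \<open>h\<^sub>n(x, y)\<close> (a Chebyshev polynomial of the second
  kind), the permanent of the Kronecker product becomes a Legendre polynomial, and the matching
  sums become powers of \<open>det Q\<close> and \<open>det R\<close>, where \<open>det Q det R = x y\<close>. So the theorem is the
  expansion of Legendre polynomials in Chebyshev polynomials, whose coefficients telescope.

  Polarization is carried out with set functions: a polynomial in \<open>Q\<close> is a zeta transform
  \<open>S \<mapsto> \<Sum>\<^bsub>A\<subseteq>S\<^esub> f A\<close>, and its multilinear part is the value of \<open>f\<close> at the full index set.
\<close>

section \<open>Zeta transforms of set functions\<close>

text \<open>A function symmetric in the rows and linear in each \<open>u u\<^sup>T\<close> becomes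
  its value at \<open>Q\<close> when summed over all maps from \<open>{0..<n}\<close> to
  \<open>S\<close>. Grouped by image, this sum is a zeta transform; on an image of size
  \<open>n\<close> the maps are bijections, all giving the same value, so the set function there is
  \<open>fact n\<close> times the original one. Complements come from products: at the full index
  set only disjoint unions reach the total degree.

  The constants: after diagonalization both permanents count pairs of two-colourings. The monomial
  \<open>x ^ k * y ^ (n - k)\<close> gets weight \<open>(n choose k)\<^sup>2 * (fact k * fact (n -
  k))\<^sup>2 = (fact n)\<^sup>2\<close> in one case and \<open>(n choose k)\<^sup>2 * fact (2 * k)
  * fact (2 * n - 2 * k) = fact (2 * n) * b k\<close> in the other, where
  \<open>b = legendre_coeff n\<close>. As \<open>b 0 = 1\<close> and \<open>b\<close> is symmetric,
  the difference expands with coefficients \<open>b (k - 1) - b k\<close>. Undoing the polarization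
  leaves \<open>coeff_C n k = (b (k - 1) - b k) * (fact k * fact (n - 2 * k) / fact
  n)\<^sup>2\<close>.\<close>

definition union_conv :: "('a set \<Rightarrow> real) \<Rightarrow> ('a set \<Rightarrow> real) \<Rightarrow> 'a set \<Rightarrow> real" where
  "union_conv f g C = (\<Sum>(A, B) | A \<subseteq> C \<and> B \<subseteq> C \<and> A \<union> B = C. f A * g B)"

text \<open>The convolution is the covering product on sets. Both \<open>A\<close> and
  \<open>B\<close> lie below \<open>S\<close> exactly when \<open>A \<union> B\<close> does, so it
  suffices to group the pairs by their union.\<close>

lemma zeta_mult:
  assumes "finite S"
  shows "(\<Sum>A\<in>Pow S. f A) * (\<Sum>B\<in>Pow S. g B) = (\<Sum>C\<in>Pow S. union_conv f g C)"
proof -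
  have "(\<Sum>A\<in>Pow S. f A) * (\<Sum>B\<in>Pow S. g B) = (\<Sum>(A, B)\<in>Pow S \<times> Pow S. f A * g B)"
    by (simp add: sum_product sum.cartesian_product)
  also have "\<dots> = (\<Sum>C\<in>Pow S. \<Sum>(A, B) | (A, B) \<in> Pow S \<times> Pow S \<and> A \<union> B = C. f A * g B)"
    by (subst sum.group[of "Pow S \<times> Pow S" "Pow S" "\<lambda>(A, B). A \<union> B", symmetric])
      (use assms in \<open>auto intro!: sum.cong\<close>)
  also have "\<dots> = (\<Sum>C\<in>Pow S. union_conv f g C)"
    unfolding union_conv_def by (intro sum.cong refl arg_cong2[where f = sum]) auto
  finally show ?thesis .
qed

text \<open>The uniqueness half of Moebius inversion on the subset lattice, without signs: by
  induction the terms at proper subsets cancel and only the value at the top remains.\<close>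

lemma zeta_unique:
  fixes f g :: "'a set \<Rightarrow> real"
  assumes "finite I" and eq: "\<And>S. S \<subseteq> I \<Longrightarrow> (\<Sum>A\<in>Pow S. f A) = (\<Sum>A\<in>Pow S. g A)"
  shows "f I = g I"
proof -
  have "S \<subseteq> I \<Longrightarrow> f S = g S" if "finite S" for S
    using that
  proof (induction S rule: finite_psubset_induct)
    case (psubset S)
    have split: "(\<Sum>A\<in>Pow S. h A) = h S + (\<Sum>A\<in>Pow S - {S}. h A)" for h :: "'a set \<Rightarrow> real"
      using psubset.hyps by (subst sum.remove[of _ S]) auto
    have "(\<Sum>A\<in>Pow S - {S}. f A) = (\<Sum>A\<in>Pow S - {S}. g A)"
      by (rule sum.cong) (use psubset in auto)
    with eq[OF psubset.prems] show ?case
      unfolding split by simp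
  qed
  with assms(1) show ?thesis by blast
qed

text \<open>Here \<open>p\<close> and \<open>q\<close> act as degree bounds. A union has at most
  \<open>card A + card B\<close> elements, so nothing survives above \<open>p + q\<close>. At
  exactly \<open>p + q\<close> both bounds are attained and the union must be disjoint, which turns
  the covering product into a sum over complements.\<close>

lemma union_conv_degree:
  assumes "finite C"
    and f: "\<And>A. A \<subseteq> C \<Longrightarrow> p < card A \<Longrightarrow> f A = 0"
    and g: "\<And>B. B \<subseteq> C \<Longrightarrow> q < card B \<Longrightarrow> g B = 0"
  shows "p + q < card C \<Longrightarrow> union_conv f g C = 0"
    and "card C = p + q \<Longrightarrow> union_conv f g C = (\<Sum>A | A \<subseteq> C \<and> card A = p. f A * g (C - A))"
proof -
  have le: "card C \<le> card A + card B" if "A \<union> B = C" for A B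
    using that card_Un_le by metis
  show "union_conv f g C = 0" if "p + q < card C"
  proof -
    have "f A * g B = 0" if "A \<union> B = C" for A B
    proof -
      have "p < card A \<or> q < card B"
        using le[OF that] \<open>p + q < card C\<close> by linarith
      with f[of A] g[of B] that show ?thesis by auto
    qed
    then show ?thesis
      unfolding union_conv_def by (intro sum.neutral) auto
  qed
  show "union_conv f g C = (\<Sum>A | A \<subseteq> C \<and> card A = p. f A * g (C - A))" if C: "card C = p + q"
  proof -
    let ?X = "{(A, B). A \<subseteq> C \<and> B \<subseteq> C \<and> A \<union> B = C}"
    let ?Y = "(\<lambda>A. (A, C - A)) ` {A. A \<subseteq> C \<and> card A = p}"
    have fin: "finite ?X"
      by (rule finite_subset[of _ "Pow C \<times> Pow C"]) (use assms(1) in auto)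
    have "f A * g B = 0" if AB: "(A, B) \<in> ?X - ?Y" for A B
    proof (rule ccontr)
      assume nz: "f A * g B \<noteq> 0"
      have AB': "A \<subseteq> C" "B \<subseteq> C" "A \<union> B = C"
        using AB by auto
      have fA: "finite A" "finite B"
        using AB' assms(1) finite_subset by blast+
      have cA: "card A \<le> p" "card B \<le> q"
        using f[of A] g[of B] nz AB' by force+
      with le[OF AB'(3)] C have cards: "card A = p" "card B = q"
        by linarith+
      have "card (A \<inter> B) = 0"
        using card_Un_Int[OF fA] AB' cards C by simp
      then have "A \<inter> B = {}"
        using fA by simp
      then have "B = C - A"
        using AB' by blast
      with cards AB AB' show False by auto
    qed
    then have "(\<Sum>(A, B)\<in>?X. f A * g B) = (\<Sum>(A, B)\<in>?Y. f A * g B)"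
      by (intro sum.mono_neutral_right fin) auto
    also have "\<dots> = (\<Sum>A | A \<subseteq> C \<and> card A = p. f A * g (C - A))"
      by (subst sum.reindex) (auto simp: inj_on_def)
    finally show ?thesis
      unfolding union_conv_def .
  qed
qed

text \<open>Sorting maps by image exhibits the sum as a zeta transform in \<open>S\<close>. The
  inner sums use \<open>extensional N\<close>, so that the set function itself does not mention
  \<open>S\<close>.\<close>

lemma sum_PiE_by_range:
  fixes h :: "('a \<Rightarrow> 'b) \<Rightarrow> real"
  assumes "finite N" "finite S"
  shows "(\<Sum>\<psi>\<in>N \<rightarrow>\<^sub>E S. h \<psi>) = (\<Sum>A\<in>Pow S. \<Sum>\<psi> | \<psi> \<in> extensional N \<and> \<psi> ` N = A. h \<psi>)"
proof -
  have "(\<Sum>\<psi>\<in>N \<rightarrow>\<^sub>E S. h \<psi>) = (\<Sum>A\<in>Pow S. \<Sum>\<psi> | \<psi> \<in> N \<rightarrow>\<^sub>E S \<and> \<psi> ` N = A. h \<psi>)"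
    using assms by (intro sum.group[symmetric] finite_PiE) auto
  also have "\<dots> = (\<Sum>A\<in>Pow S. \<Sum>\<psi> | \<psi> \<in> extensional N \<and> \<psi> ` N = A. h \<psi>)"
    by (intro sum.cong refl arg_cong2[where f = sum]) (auto simp: PiE_def)
  finally show ?thesis .
qed

lemma card_extensional_onto:
  assumes "finite N" "finite A" "card A = card N"
  shows "card {\<psi>. \<psi> \<in> extensional N \<and> \<psi> ` N = A} = fact (card N)"
proof -
  have "{\<psi>. \<psi> \<in> extensional N \<and> \<psi> ` N = A} = {\<psi> \<in> N \<rightarrow>\<^sub>E A. inj_on \<psi> N}"
  proof (rule equalityI; rule subsetI)
    fix \<psi> assume "\<psi> \<in> {\<psi>. \<psi> \<in> extensional N \<and> \<psi> ` N = A}"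
    then show "\<psi> \<in> {\<psi> \<in> N \<rightarrow>\<^sub>E A. inj_on \<psi> N}"
      using assms eq_card_imp_inj_on[of N \<psi>] by (auto simp: PiE_def)
  next
    fix \<psi> assume "\<psi> \<in> {\<psi> \<in> N \<rightarrow>\<^sub>E A. inj_on \<psi> N}"
    then show "\<psi> \<in> {\<psi>. \<psi> \<in> extensional N \<and> \<psi> ` N = A}"
      using assms card_subset_eq[of A "\<psi> ` N"] by (auto simp: PiE_def card_image)
  qed
  then show ?thesis
    using card_inj_on_subset_funcset[of N A N] assms
    by (simp add: fact_prod_rev)
qed

section \<open>Sums over permutations\<close>

text \<open>Composition with \<open>\<pi>\<close> on the left and with the inverse of
  \<open>\<kappa>\<close> on the right permutes the summands: a permanent is invariant under
  independent permutations of rows and columns.\<close>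

lemma perm_sum_reindex:
  fixes b :: "'a \<Rightarrow> 'a \<Rightarrow> real"
  assumes "finite S" "\<kappa> permutes S" "\<pi> permutes S"
  shows "(\<Sum>\<sigma> | \<sigma> permutes S. \<Prod>i\<in>S. b (\<kappa> i) (\<pi> (\<sigma> i))) = (\<Sum>\<sigma> | \<sigma> permutes S. \<Prod>i\<in>S. b i (\<sigma> i))"
proof -
  have "(\<Sum>\<sigma> | \<sigma> permutes S. \<Prod>i\<in>S. b i (\<sigma> i)) = (\<Sum>\<sigma> | \<sigma> permutes S. \<Prod>i\<in>S. b i (\<pi> (\<sigma> i)))"
    by (subst setum_permutations_compose_left[OF assms(3)]) simp
  also have "\<dots> = (\<Sum>\<sigma> | \<sigma> permutes S. \<Prod>i\<in>S. b i (\<pi> (\<sigma> (Hilbert_Choice.inv \<kappa> i))))"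
    by (subst sum_permutations_compose_right[OF permutes_inv[OF assms(2)]]) simp
  also have "\<dots> = (\<Sum>\<sigma> | \<sigma> permutes S. \<Prod>i\<in>S. b (\<kappa> i) (\<pi> (\<sigma> i)))"
    by (subst prod.permute[OF assms(2)]) (simp add: permutes_inverses[OF assms(2)])
  finally show ?thesis ..
qed

lemma bij_betw_factor_permutes:
  assumes "bij_betw p N A" "bij_betw \<psi> N A"
  obtains \<kappa> where "\<kappa> permutes N" "\<And>i. i \<in> N \<Longrightarrow> \<psi> i = p (\<kappa> i)"
proof
  have "bij_betw (inv_into N p \<circ> \<psi>) N N"
    using assms bij_betw_trans bij_betw_inv_into by blast
  then show "restrict_id (inv_into N p \<circ> \<psi>) N permutes N"
    by (rule permutes_restrict_id)
  show "\<psi> i = p (restrict_id (inv_into N p \<circ> \<psi>) N i)" if "i \<in> N" for i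
    using that assms by (simp add: bij_betw_inv_into_right[OF assms(1)] bij_betw_apply)
qed

text \<open>Two bijections onto the same set differ by a permutation, so every labelling of rows and
  columns gives the same permanent. The labels may have any type, which later allows pairs as labels
  of doubled indices.\<close>

lemma perm_sum_bij_cong:
  fixes b :: "'b \<Rightarrow> 'c \<Rightarrow> real"
  assumes "finite N" "bij_betw p N A" "bij_betw \<psi> N A" "bij_betw q N B" "bij_betw \<phi> N B"
  shows "(\<Sum>\<sigma> | \<sigma> permutes N. \<Prod>i\<in>N. b (\<psi> i) (\<phi> (\<sigma> i)))
    = (\<Sum>\<sigma> | \<sigma> permutes N. \<Prod>i\<in>N. b (p i) (q (\<sigma> i)))"
proof -
  obtain \<kappa> where \<kappa>: "\<kappa> permutes N" "\<And>i. i \<in> N \<Longrightarrow> \<psi> i = p (\<kappa> i)"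
    using bij_betw_factor_permutes assms(2,3) by blast
  obtain \<pi> where \<pi>: "\<pi> permutes N" "\<And>i. i \<in> N \<Longrightarrow> \<phi> i = q (\<pi> i)"
    using bij_betw_factor_permutes assms(4,5) by blast
  have "(\<Sum>\<sigma> | \<sigma> permutes N. \<Prod>i\<in>N. b (\<psi> i) (\<phi> (\<sigma> i)))
    = (\<Sum>\<sigma> | \<sigma> permutes N. \<Prod>i\<in>N. b (p (\<kappa> i)) (q (\<pi> (\<sigma> i))))"
    by (intro sum.cong prod.cong refl) (auto simp: \<kappa>(2) \<pi>(2) permutes_in_image)
  also have "\<dots> = (\<Sum>\<sigma> | \<sigma> permutes N. \<Prod>i\<in>N. b (p i) (q (\<sigma> i)))"
    using perm_sum_reindex[OF assms(1) \<kappa>(1) \<pi>(1), of "\<lambda>i j. b (p i) (q j)"] .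
  finally show ?thesis .
qed

lemma ex_permutes_image:
  assumes "finite S" "A \<subseteq> S" "B \<subseteq> S" "card A = card B"
  obtains \<pi> where "\<pi> permutes S" "\<pi> ` A = B"
proof -
  have fin: "finite A" "finite B"
    using assms finite_subset by blast+
  obtain f where f: "bij_betw f A B"
    using finite_same_card_bij fin assms(4) by blast
  have "card (S - A) = card (S - B)"
    using assms fin by (simp add: card_Diff_subset)
  then obtain g where g: "bij_betw g (S - A) (S - B)"
    using finite_same_card_bij assms(1) by blast
  define h where "h x = (if x \<in> A then f x else g x)" for x
  have "bij_betw h (A \<union> (S - A)) (B \<union> (S - B))"
    unfolding h_def by (rule bij_betw_disjoint_Un) (use f g in auto)
  then have "bij_betw h S S"
    using assms by (simp add: Un_absorb1)
  then have "restrict_id h S permutes S"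
    by (rule permutes_restrict_id)
  moreover have "restrict_id h S ` A = B"
    using f assms(2) by (auto simp: h_def bij_betw_def subset_iff image_iff)
  ultimately show ?thesis
    using that by blast
qed

text \<open>Composing with a permutation that moves \<open>A\<close> to \<open>A'\<close> shows that
  all images of the right size occur equally often, so the \<open>fact (card S)\<close> permutations
  are shared evenly among \<open>card S choose card B\<close> sets.\<close>

lemma card_permutes_image:
  assumes "finite S" "A \<subseteq> S" "B \<subseteq> S"
  shows "card {\<sigma>. \<sigma> permutes S \<and> \<sigma> ` B = A} =
    (if card A = card B then fact (card B) * fact (card S - card B) else 0)"
proof (cases "card A = card B")
  case True
  define K where "K A = card {\<sigma>. \<sigma> permutes S \<and> \<sigma> ` B = A}" for A
  have K: "K A' = K A" if A': "A' \<subseteq> S" "card A' = card B" for A'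
  proof -
    obtain \<pi> where \<pi>: "\<pi> permutes S" "\<pi> ` A = A'"
      using ex_permutes_image[of S A A'] assms A' True by metis
    have "bij_betw (\<lambda>\<sigma>. \<pi> \<circ> \<sigma>) {\<sigma>. \<sigma> permutes S \<and> \<sigma> ` B = A} {\<sigma>. \<sigma> permutes S \<and> \<sigma> ` B = A'}"
    proof (rule bij_betw_byWitness[where f' = "\<lambda>\<sigma>. Hilbert_Choice.inv \<pi> \<circ> \<sigma>"])
      have "Hilbert_Choice.inv \<pi> ` A' = A"
        using \<pi> by (metis bij_def image_inv_f_f permutes_bij)
      then show "(\<lambda>\<sigma>. Hilbert_Choice.inv \<pi> \<circ> \<sigma>) ` {\<sigma>. \<sigma> permutes S \<and> \<sigma> ` B = A'} \<subseteq> {\<sigma>. \<sigma> permutes S \<and> \<sigma> ` B = A}"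
        using \<pi> by (auto intro: permutes_compose permutes_inv simp flip: image_image)
    qed (use \<pi> in \<open>auto intro: permutes_compose simp: fun_eq_iff permutes_inverses simp flip: image_image\<close>)
    then show ?thesis
      unfolding K_def by (simp add: bij_betw_same_card)
  qed
  have "fact (card S) = card {\<sigma>. \<sigma> permutes S}"
    using card_permutations[of S] assms(1) by simp
  also have "\<dots> = (\<Sum>A' | A' \<subseteq> S \<and> card A' = card B. K A')"
  proof -
    have "(\<Sum>A' | A' \<subseteq> S \<and> card A' = card B. \<Sum>\<sigma> | \<sigma> \<in> {\<sigma>. \<sigma> permutes S} \<and> \<sigma> ` B = A'. (1::nat))
        = (\<Sum>\<sigma> | \<sigma> permutes S. 1)"
    proof (rule sum.group)
      show "(\<lambda>\<sigma>. \<sigma> ` B) ` {\<sigma>. \<sigma> permutes S} \<subseteq> {A'. A' \<subseteq> S \<and> card A' = card B}"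
        using assms(3) by (auto simp: permutes_in_image card_image permutes_inj_on subset_iff)
    qed (use assms(1) finite_permutations in auto)
    then show ?thesis
      by (simp add: K_def)
  qed
  also have "\<dots> = (card S choose card B) * K A"
    using n_subsets[OF assms(1)] K by simp
  finally have "fact (card S) = (card S choose card B) * K A" .
  moreover have "fact (card B) * fact (card S - card B) * (card S choose card B) = fact (card S)"
    using binomial_fact_lemma card_mono[OF assms(1,3)] by blast
  moreover have "card S choose card B > 0"
    using card_mono[OF assms(1,3)] by simp
  ultimately have "K A = fact (card B) * fact (card S - card B)"
    by (metis mult.commute mult_cancel_left less_numeral_extra(3))
  with True show ?thesis
    by (simp add: K_def)
next
  case False
  then have "{\<sigma>. \<sigma> permutes S \<and> \<sigma> ` B = A} = {}"
    by (auto simp: card_image permutes_inj_on)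
  then show ?thesis
    using False by (simp only: card.empty if_False)
qed

section \<open>Simultaneous diagonalization of Gram matrices\<close>

definition dot :: "real \<times> real \<Rightarrow> real \<times> real \<Rightarrow> real" where
  "dot x y = fst x * fst y + snd x * snd y"

text \<open>This is \<open>det Q\<close> for the matrix \<open>Q\<close> of second moments of the
  vectors \<open>u s\<close>.\<close>

definition gram_det :: "('a \<Rightarrow> real \<times> real) \<Rightarrow> 'a set \<Rightarrow> real" where
  "gram_det u S = (\<Sum>s\<in>S. (fst (u s))\<^sup>2) * (\<Sum>s\<in>S. (snd (u s))\<^sup>2) - (\<Sum>s\<in>S. fst (u s) * snd (u s))\<^sup>2"

lemma dot_commute: "dot x y = dot y x"
  by (simp add: dot_def mult.commute)

lemma sum_dot_dot:
  "(\<Sum>t\<in>T. dot x (v t) * dot y (v t)) =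
    fst x * fst y * (\<Sum>t\<in>T. (fst (v t))\<^sup>2) + (fst x * snd y + snd x * fst y) * (\<Sum>t\<in>T. fst (v t) * snd (v t)) +
    snd x * snd y * (\<Sum>t\<in>T. (snd (v t))\<^sup>2)"
  unfolding dot_def sum_distrib_left sum.distrib[symmetric]
  by (intro sum.cong refl) (simp add: algebra_simps power2_eq_square)

text \<open>Lagrange's identity, or Cauchy-Binet for two columns; the factor 2 is due to ordered
  pairs. It gives nonnegativity here and the edge weights of matchings later.\<close>

lemma double_gram_det:
  "2 * gram_det u S = (\<Sum>i\<in>S. \<Sum>j\<in>S. (fst (u i) * snd (u j) - snd (u i) * fst (u j))\<^sup>2)"
proof -
  have "(\<Sum>i\<in>S. \<Sum>j\<in>S. (fst (u i) * snd (u j) - snd (u i) * fst (u j))\<^sup>2) =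
    (\<Sum>i\<in>S. \<Sum>j\<in>S. (fst (u i))\<^sup>2 * (snd (u j))\<^sup>2) + (\<Sum>i\<in>S. \<Sum>j\<in>S. (snd (u i))\<^sup>2 * (fst (u j))\<^sup>2) -
    2 * (\<Sum>i\<in>S. \<Sum>j\<in>S. (fst (u i) * snd (u i)) * (fst (u j) * snd (u j)))"
    unfolding sum_distrib_left sum.distrib[symmetric] sum_subtractf[symmetric]
    by (intro sum.cong refl) (simp add: algebra_simps power2_eq_square)
  then show ?thesis
    unfolding sum_product[symmetric] gram_det_def by (simp add: power2_eq_square)
qed

lemma gram_det_nonneg: "gram_det u S \<ge> 0"
proof -
  have "2 * gram_det u S \<ge> 0"
    unfolding double_gram_det by (intro sum_nonneg) simp
  then show ?thesis by simp
qed

text \<open>Cholesky factorization. If the pivot \<open>r00\<close> vanishes, the determinant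
  condition forces \<open>r01 = 0\<close>.\<close>

lemma psd_factor:
  fixes r00 r01 r11 :: real
  assumes "r00 \<ge> 0" "r11 \<ge> 0" "r01\<^sup>2 \<le> r00 * r11"
  obtains a b a' b' where "a\<^sup>2 + a'\<^sup>2 = r00" "a * b + a' * b' = r01" "b\<^sup>2 + b'\<^sup>2 = r11"
proof (cases "r00 = 0")
  case True
  then show ?thesis
    using assms that[of 0 0 "sqrt r11" 0] by simp
next
  case False
  with assms have pos: "r00 > 0" by simp
  then have "r11 - r01\<^sup>2 / r00 \<ge> 0"
    using assms(3) by (simp add: field_simps)
  then show ?thesis
    using pos that[of "sqrt r00" 0 "r01 / sqrt r00" "sqrt (r11 - r01\<^sup>2 / r00)"]
    by (simp add: power_divide)
qed

text \<open>A Jacobi rotation: in the double angle the condition reads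
  \<open>sin (2 * t) * q + cos (2 * t) * (2 * p) = 0\<close>, so \<open>2 * t\<close> can be taken
  as the angle of the vector \<open>(q, - 2 * p)\<close>.\<close>

lemma ex_rotation_annihilating:
  fixes p q :: real
  obtains c s :: real where "c\<^sup>2 + s\<^sup>2 = 1" "(c\<^sup>2 - s\<^sup>2) * p + c * s * q = 0"
proof -
  define h where "h = sqrt (q\<^sup>2 + 4 * p\<^sup>2)"
  obtain t where t: "sin (2 * t) * q + cos (2 * t) * (2 * p) = 0"
  proof (cases "h = 0")
    case True
    then have "q = 0" "p = 0"
      by (auto simp: h_def add_nonneg_eq_0_iff)
    then show ?thesis using that by simp
  next
    case False
    then have nz: "q\<^sup>2 + 4 * p\<^sup>2 \<noteq> 0"
      by (auto simp: h_def)
    have "(q / h)\<^sup>2 + (- (2 * p) / h)\<^sup>2 = (q\<^sup>2 + 4 * p\<^sup>2) / h\<^sup>2"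
      by (simp add: power_divide power_mult_distrib add_divide_distrib)
    also have "\<dots> = 1"
      using nz by (simp add: h_def)
    finally obtain z where z: "q / h = cos z" "- (2 * p) / h = sin z"
      using sincos_total_2pi by metis
    have "h * (sin z * q + cos z * (2 * p)) = 0"
      using False unfolding z[symmetric] by (simp add: field_simps)
    with False show ?thesis
      using that[of "z / 2"] by simp
  qed
  then have "((cos t)\<^sup>2 - (sin t)\<^sup>2) * p + cos t * sin t * q = 0"
    unfolding sin_double cos_double by (simp add: algebra_simps)
  then show ?thesis
    using that[of "cos t" "sin t"] by simp
qed

text \<open>A factorization \<open>R = W W\<^sup>T\<close> stays valid when \<open>W\<close> is rotated, and a rotation makes
  \<open>W\<^sup>T Q W\<close> diagonal.\<close>

lemma simultaneous_diagonalization: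
  fixes u :: "'a \<Rightarrow> real \<times> real" and v :: "'b \<Rightarrow> real \<times> real"
  obtains w :: "bool \<Rightarrow> real \<times> real" and l :: "bool \<Rightarrow> real"
  where "\<And>x y. (\<Sum>t\<in>T. dot x (v t) * dot y (v t)) = (\<Sum>c\<in>UNIV. dot x (w c) * dot y (w c))"
    and "\<And>c d. (\<Sum>s\<in>S. dot (w c) (u s) * dot (w d) (u s)) = (if c = d then l c else 0)"
    and "\<And>c. l c \<ge> 0"
    and "gram_det u S * gram_det v T = l True * l False"
proof -
  define r00 where "r00 = (\<Sum>t\<in>T. (fst (v t))\<^sup>2)"
  define r01 where "r01 = (\<Sum>t\<in>T. fst (v t) * snd (v t))"
  define r11 where "r11 = (\<Sum>t\<in>T. (snd (v t))\<^sup>2)"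
  define q00 where "q00 = (\<Sum>s\<in>S. (fst (u s))\<^sup>2)"
  define q01 where "q01 = (\<Sum>s\<in>S. fst (u s) * snd (u s))"
  define q11 where "q11 = (\<Sum>s\<in>S. (snd (u s))\<^sup>2)"
  have "r01\<^sup>2 \<le> r00 * r11"
    using gram_det_nonneg[of v T] by (simp add: gram_det_def r01_def r00_def r11_def)
  moreover have "r00 \<ge> 0" "r11 \<ge> 0"
    by (auto simp: r00_def r11_def intro: sum_nonneg)
  ultimately obtain a b a' b' where ab: "a\<^sup>2 + a'\<^sup>2 = r00" "a * b + a' * b' = r01" "b\<^sup>2 + b'\<^sup>2 = r11"
    using psd_factor by metis
  define Q where "Q x y = fst x * fst y * q00 + (fst x * snd y + snd x * fst y) * q01 + snd x * snd y * q11" for x y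
  \<comment> \<open>With \<open>x = (a, b)\<close> and \<open>y = (a', b')\<close>, the expression
    made zero is \<open>Q (c x + s y) (c y - s x)\<close>, the off-diagonal entry after the
    rotation.\<close>
  obtain c s where cs: "c\<^sup>2 + s\<^sup>2 = 1"
    "(c\<^sup>2 - s\<^sup>2) * Q (a, b) (a', b') + c * s * (Q (a', b') (a', b') - Q (a, b) (a, b)) = 0"
    using ex_rotation_annihilating by metis
  define w where "w z = (if z then (c * a + s * a', c * b + s * b') else (c * a' - s * a, c * b' - s * b))" for z
  define l where "l z = Q (w z) (w z)" for z
  have Q: "(\<Sum>i\<in>S. dot x (u i) * dot y (u i)) = Q x y" for x y
    unfolding sum_dot_dot Q_def q00_def q01_def q11_def ..
  have Qsym: "Q x y = Q y x" for x y
    by (simp add: Q_def algebra_simps)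
  have orth: "Q (w True) (w False) = 0"
    using cs(2) by (simp add: w_def Q_def algebra_simps power2_eq_square)
  have R: "(\<Sum>t\<in>T. dot x (v t) * dot y (v t)) = (\<Sum>z\<in>UNIV. dot x (w z) * dot y (w z))" for x y
  proof -
    have "(\<Sum>z\<in>UNIV. dot x (w z) * dot y (w z)) = (c\<^sup>2 + s\<^sup>2) *
      (fst x * fst y * (a\<^sup>2 + a'\<^sup>2) + (fst x * snd y + snd x * fst y) * (a * b + a' * b') + snd x * snd y * (b\<^sup>2 + b'\<^sup>2))"
      by (simp add: UNIV_bool w_def dot_def algebra_simps power2_eq_square)
    then show ?thesis
      unfolding cs(1) ab sum_dot_dot r00_def r01_def r11_def by simp
  qed
  have nonneg: "l z \<ge> 0" for z
    unfolding l_def Q[symmetric] by (intro sum_nonneg) simp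
  \<comment> \<open>Multiplicativity of determinants: \<open>W\<^sup>T Q W\<close> has determinant
    \<open>det Q * (det W)\<^sup>2\<close>, where \<open>(det W)\<^sup>2 = det R\<close> and the
    rotation does not change \<open>det W\<close>.\<close>
  have "l True * l False - (Q (w True) (w False))\<^sup>2 = (q00 * q11 - q01\<^sup>2) *
      ((fst (w True) * snd (w False) - snd (w True) * fst (w False))\<^sup>2)"
    by (simp add: l_def Q_def algebra_simps power2_eq_square)
  also have "fst (w True) * snd (w False) - snd (w True) * fst (w False) = (c\<^sup>2 + s\<^sup>2) * (a * b' - b * a')"
    by (simp add: w_def algebra_simps power2_eq_square)
  also have "((c\<^sup>2 + s\<^sup>2) * (a * b' - b * a'))\<^sup>2 = r00 * r11 - r01\<^sup>2"
    unfolding cs(1) ab[symmetric] by (simp add: algebra_simps power2_eq_square)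
  finally have "gram_det u S * gram_det v T = l True * l False"
    by (simp add: orth gram_det_def q00_def q01_def q11_def r00_def r01_def r11_def)
  moreover have "(\<Sum>i\<in>S. dot (w z) (u i) * dot (w z') (u i)) = (if z = z' then l z else 0)" for z z'
    unfolding Q using orth Qsym[of "w False" "w True"] by (cases z; cases z') (auto simp: l_def)
  ultimately show ?thesis
    using that[of w l] R nonneg by blast
qed

section \<open>Sums over index maps in which every index occurs twice\<close>

lemma sum_PiE_prod_fibres:
  fixes X :: "'m \<Rightarrow> 't \<Rightarrow> real"
  assumes "finite M" "finite N" "finite T" "g ` M \<subseteq> N"
  shows "(\<Sum>\<phi>\<in>N \<rightarrow>\<^sub>E T. \<Prod>m\<in>M. X m (\<phi> (g m))) = (\<Prod>j\<in>N. \<Sum>t\<in>T. \<Prod>m | m \<in> M \<and> g m = j. X m t)"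
proof -
  have "(\<Prod>m\<in>M. X m (\<phi> (g m))) = (\<Prod>j\<in>N. \<Prod>m | m \<in> M \<and> g m = j. X m (\<phi> j))" for \<phi>
    by (subst prod.group[OF assms(1,2,4), symmetric]) (auto intro!: prod.cong)
  then show ?thesis
    by (simp add: prod_sum_PiE assms)
qed

text \<open>With fibres of size 2 every index enters quadratically, so only second moments matter.\<close>

lemma sum_PiE_prod_fibres_cong:
  fixes X :: "'m \<Rightarrow> 't \<Rightarrow> real" and Y :: "'m \<Rightarrow> 'c \<Rightarrow> real"
  assumes "finite M" "finite N" "finite T" "finite C" "g ` M \<subseteq> N"
    and fib: "\<And>j. j \<in> N \<Longrightarrow> card {m \<in> M. g m = j} = 2"
    and XY: "\<And>m m'. m \<in> M \<Longrightarrow> m' \<in> M \<Longrightarrow> g m = g m' \<Longrightarrow>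
      (\<Sum>t\<in>T. X m t * X m' t) = (\<Sum>c\<in>C. Y m c * Y m' c)"
  shows "(\<Sum>\<phi>\<in>N \<rightarrow>\<^sub>E T. \<Prod>m\<in>M. X m (\<phi> (g m))) = (\<Sum>\<phi>\<in>N \<rightarrow>\<^sub>E C. \<Prod>m\<in>M. Y m (\<phi> (g m)))"
proof -
  have "(\<Sum>t\<in>T. \<Prod>m | m \<in> M \<and> g m = j. X m t) = (\<Sum>c\<in>C. \<Prod>m | m \<in> M \<and> g m = j. Y m c)"
    if j: "j \<in> N" for j
  proof -
    obtain m m' where mm: "{m \<in> M. g m = j} = {m, m'}" "m \<noteq> m'"
      using fib[OF j] by (auto simp: card_2_iff)
    have "m \<in> {m \<in> M. g m = j}" "m' \<in> {m \<in> M. g m = j}"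
      unfolding mm(1) by auto
    then have "m \<in> M" "m' \<in> M" "g m = g m'"
      by auto
    with XY mm(2) show ?thesis
      unfolding mm(1) by simp
  qed
  then show ?thesis
    by (simp add: sum_PiE_prod_fibres assms)
qed

text \<open>Every row index \<open>f m\<close> and every column index \<open>g m\<close> occurs in
  exactly two factors, so the sum over \<open>T\<close> can be traded for one over the two vectors
  \<open>w\<close>, and then the sum over \<open>S\<close> for one over two orthogonal directions.
  What remains are a colouring \<open>c\<close> of the columns and a colouring \<open>d\<close> of
  the rows that must agree at every factor. Both permanents are instances.\<close>

lemma double_sum_dot_eq:
  fixes u :: "'a \<Rightarrow> real \<times> real" and v :: "'b \<Rightarrow> real \<times> real" and w :: "bool \<Rightarrow> real \<times> real"
  assumes R: "\<And>x y. (\<Sum>t\<in>T. dot x (v t) * dot y (v t)) = (\<Sum>c\<in>UNIV. dot x (w c) * dot y (w c))"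
    and Q: "\<And>c d. (\<Sum>s\<in>S. dot (w c) (u s) * dot (w d) (u s)) = (if c = d then l c else 0)"
    and l: "\<And>c. l c \<ge> 0"
    and fin: "finite M" "finite N" "finite S" "finite T"
    and f: "f ` M \<subseteq> N" "\<And>j. j \<in> N \<Longrightarrow> card {m \<in> M. f m = j} = 2"
    and g: "g ` M \<subseteq> N" "\<And>j. j \<in> N \<Longrightarrow> card {m \<in> M. g m = j} = 2"
  shows "(\<Sum>\<psi>\<in>N \<rightarrow>\<^sub>E S. \<Sum>\<phi>\<in>N \<rightarrow>\<^sub>E T. \<Prod>m\<in>M. dot (u (\<psi> (f m))) (v (\<phi> (g m)))) =
    (\<Sum>c\<in>N \<rightarrow>\<^sub>E UNIV. \<Sum>d\<in>N \<rightarrow>\<^sub>E UNIV. if \<forall>m\<in>M. c (g m) = d (f m) then \<Prod>j\<in>N. l (d j) else 0)"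
proof -
  have "(\<Sum>\<psi>\<in>N \<rightarrow>\<^sub>E S. \<Sum>\<phi>\<in>N \<rightarrow>\<^sub>E T. \<Prod>m\<in>M. dot (u (\<psi> (f m))) (v (\<phi> (g m)))) =
    (\<Sum>\<psi>\<in>N \<rightarrow>\<^sub>E S. \<Sum>c\<in>N \<rightarrow>\<^sub>E UNIV. \<Prod>m\<in>M. dot (u (\<psi> (f m))) (w (c (g m))))"
    by (rule sum.cong[OF refl], rule sum_PiE_prod_fibres_cong) (use fin g R in auto)
  also have "\<dots> = (\<Sum>c\<in>N \<rightarrow>\<^sub>E UNIV. \<Sum>\<psi>\<in>N \<rightarrow>\<^sub>E S. \<Prod>m\<in>M. dot (w (c (g m))) (u (\<psi> (f m))))"
    by (subst sum.swap) (simp add: dot_commute)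
  \<comment> \<open>The square roots split each eigenvalue evenly over the two elements of a fibre.\<close>
  also have "\<dots> = (\<Sum>c\<in>N \<rightarrow>\<^sub>E UNIV. \<Sum>d\<in>N \<rightarrow>\<^sub>E UNIV. \<Prod>m\<in>M. if d (f m) = c (g m) then sqrt (l (d (f m))) else 0)"
  proof (rule sum.cong[OF refl], rule sum_PiE_prod_fibres_cong)
    fix c :: "'d \<Rightarrow> bool" and m m'
    show "(\<Sum>t\<in>S. dot (w (c (g m))) (u t) * dot (w (c (g m'))) (u t)) =
       (\<Sum>z\<in>UNIV. (if z = c (g m) then sqrt (l z) else 0) * (if z = c (g m') then sqrt (l z) else 0))"
      unfolding Q using l by (cases "c (g m)"; cases "c (g m')") (auto simp: UNIV_bool)
  qed (use fin f in auto)
  also have "\<dots> = (\<Sum>c\<in>N \<rightarrow>\<^sub>E UNIV. \<Sum>d\<in>N \<rightarrow>\<^sub>E UNIV. if \<forall>m\<in>M. c (g m) = d (f m) then \<Prod>j\<in>N. l (d j) else 0)"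
  proof (intro sum.cong refl)
    fix c d :: "'d \<Rightarrow> bool"
    have "(\<Prod>m\<in>M. sqrt (l (d (f m)))) = (\<Prod>j\<in>N. \<Prod>m | m \<in> M \<and> f m = j. sqrt (l (d (f m))))"
      by (rule prod.group[symmetric]) (use fin f in auto)
    also have "\<dots> = (\<Prod>j\<in>N. \<Prod>m | m \<in> M \<and> f m = j. sqrt (l (d j)))"
      by (intro prod.cong) auto
    also have "\<dots> = (\<Prod>j\<in>N. l (d j))"
      by (intro prod.cong refl) (simp add: f(2) l)
    finally have "(\<Prod>m\<in>M. sqrt (l (d (f m)))) = (\<Prod>j\<in>N. l (d j))" .
    then show "(\<Prod>m\<in>M. if d (f m) = c (g m) then sqrt (l (d (f m))) else 0) =
        (if \<forall>m\<in>M. c (g m) = d (f m) then \<Prod>j\<in>N. l (d j) else 0)"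
      using fin(1) by (auto cong: prod.cong)
  qed
  finally show ?thesis .
qed

section \<open>Counting two-colourings and the permutations that match them\<close>

lemma sum_bool_functions:
  assumes "finite N"
  shows "(\<Sum>d\<in>N \<rightarrow>\<^sub>E UNIV. F {i \<in> N. d i}) = (\<Sum>B\<in>Pow N. F B)"
proof -
  have "bij_betw (\<lambda>d. {i \<in> N. d i}) (N \<rightarrow>\<^sub>E UNIV) (Pow N)"
    by (rule bij_betw_byWitness[where f' = "\<lambda>B. restrict (\<lambda>i. i \<in> B) N"])
      (auto simp: fun_eq_iff restrict_def PiE_def extensional_def)
  from sum.reindex_bij_betw[OF this] show ?thesis .
qed

lemma sum_Pow_card:
  fixes F :: "nat \<Rightarrow> real"
  assumes "finite N"
  shows "(\<Sum>B\<in>Pow N. F (card B)) = (\<Sum>k\<le>card N. (card N choose k) * F k)"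
proof -
  have "(\<Sum>B\<in>Pow N. F (card B)) = (\<Sum>k\<le>card N. \<Sum>B | B \<in> Pow N \<and> card B = k. F (card B))"
    using assms by (intro sum.group[symmetric]) (auto simp: card_mono)
  also have "\<dots> = (\<Sum>k\<le>card N. (card N choose k) * F k)"
    using n_subsets[OF assms] by (intro sum.cong) auto
  finally show ?thesis .
qed

lemma prod_bool_function:
  fixes l :: "bool \<Rightarrow> real"
  assumes "finite N"
  shows "(\<Prod>j\<in>N. l (d j)) = l True ^ card {i \<in> N. d i} * l False ^ (card N - card {i \<in> N. d i})"
proof -
  have "(\<Prod>j\<in>N. l (d j)) = (\<Prod>j\<in>{i \<in> N. d i}. l True) * (\<Prod>j\<in>N - {i \<in> N. d i}. l False)"
    using prod.subset_diff[of "{i \<in> N. d i}" N "\<lambda>j. l (d j)"] assms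
    by (simp add: mult.commute)
  then show ?thesis
    using assms by (simp add: card_Diff_subset)
qed

text \<open>A permutation matches the colourings as soon as it carries one \<open>True\<close> class
  onto the other; the \<open>False\<close> classes follow by complement.\<close>

lemma card_permutes_bool:
  assumes "finite N"
  shows "card {\<sigma>. \<sigma> permutes N \<and> (\<forall>i\<in>N. c (\<sigma> i) = d i)} =
    (if card {i \<in> N. c i} = card {i \<in> N. d i}
     then fact (card {i \<in> N. d i}) * fact (card N - card {i \<in> N. d i}) else 0)"
proof -
  have "(\<forall>i\<in>N. c (\<sigma> i) = d i) \<longleftrightarrow> \<sigma> ` {i \<in> N. d i} = {i \<in> N. c i}" if \<sigma>: "\<sigma> permutes N" for \<sigma>
  proof
    assume *: "\<forall>i\<in>N. c (\<sigma> i) = d i"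
    show "\<sigma> ` {i \<in> N. d i} = {i \<in> N. c i}"
    proof (rule equalityI; rule subsetI)
      fix x assume x: "x \<in> {i \<in> N. c i}"
      then obtain y where "y \<in> N" "x = \<sigma> y"
        using permutes_image[OF \<sigma>] by blast
      with x * show "x \<in> \<sigma> ` {i \<in> N. d i}" by auto
    qed (use * permutes_in_image[OF \<sigma>] in auto)
  next
    assume *: "\<sigma> ` {i \<in> N. d i} = {i \<in> N. c i}"
    show "\<forall>i\<in>N. c (\<sigma> i) = d i"
    proof
      fix i assume i: "i \<in> N"
      have "d i \<longleftrightarrow> \<sigma> i \<in> \<sigma> ` {i \<in> N. d i}"
        using i permutes_inj[OF \<sigma>] by (auto simp: inj_def)
      also have "\<dots> \<longleftrightarrow> c (\<sigma> i)"
        using i unfolding * by (simp add: permutes_in_image[OF \<sigma>])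
      finally show "c (\<sigma> i) = d i" by simp
    qed
  qed
  then have "{\<sigma>. \<sigma> permutes N \<and> (\<forall>i\<in>N. c (\<sigma> i) = d i)} =
      {\<sigma>. \<sigma> permutes N \<and> \<sigma> ` {i \<in> N. d i} = {i \<in> N. c i}}"
    by blast
  then show ?thesis
    using card_permutes_image[OF assms, of "{i \<in> N. c i}" "{i \<in> N. d i}"] by simp
qed

lemma sum_bool_pairs:
  fixes F :: "nat \<Rightarrow> nat \<Rightarrow> real"
  assumes "finite N" and "\<And>j k. j \<noteq> k \<Longrightarrow> F j k = 0"
  shows "(\<Sum>c\<in>N \<rightarrow>\<^sub>E UNIV. \<Sum>d\<in>N \<rightarrow>\<^sub>E UNIV. F (card {i \<in> N. c i}) (card {i \<in> N. d i})) =
    (\<Sum>k\<le>card N. (real (card N choose k))\<^sup>2 * F k k)"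
proof -
  have "(\<Sum>c\<in>N \<rightarrow>\<^sub>E UNIV. \<Sum>d\<in>N \<rightarrow>\<^sub>E UNIV. F (card {i \<in> N. c i}) (card {i \<in> N. d i})) =
    (\<Sum>c\<in>N \<rightarrow>\<^sub>E UNIV. \<Sum>k\<le>card N. (card N choose k) * F (card {i \<in> N. c i}) k)"
  proof (intro sum.cong refl)
    fix c :: "'a \<Rightarrow> bool"
    show "(\<Sum>d\<in>N \<rightarrow>\<^sub>E UNIV. F (card {i \<in> N. c i}) (card {i \<in> N. d i})) =
      (\<Sum>k\<le>card N. (card N choose k) * F (card {i \<in> N. c i}) k)"
      using sum_bool_functions[OF assms(1), of "\<lambda>B. F (card {i \<in> N. c i}) (card B)"]
        sum_Pow_card[OF assms(1), of "F (card {i \<in> N. c i})"] by simp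
  qed
  also have "\<dots> = (\<Sum>j\<le>card N. (card N choose j) * (\<Sum>k\<le>card N. (card N choose k) * F j k))"
    using sum_bool_functions[OF assms(1), of "\<lambda>A. \<Sum>k\<le>card N. (card N choose k) * F (card A) k"]
      sum_Pow_card[OF assms(1), of "\<lambda>j. \<Sum>k\<le>card N. (card N choose k) * F j k"] by simp
  also have "\<dots> = (\<Sum>k\<le>card N. (real (card N choose k))\<^sup>2 * F k k)"
  proof (rule sum.cong[OF refl])
    fix j assume j: "j \<in> {..card N}"
    have "(\<Sum>k\<le>card N. (card N choose k) * F j k) = (\<Sum>k\<in>{j}. (card N choose k) * F j k)"
      by (rule sum.mono_neutral_right) (use j assms(2) in auto)
    then show "(card N choose j) * (\<Sum>k\<le>card N. (card N choose k) * F j k) = (real (card N choose j))\<^sup>2 * F j j"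
      by (simp add: power2_eq_square)
  qed
  finally show ?thesis .
qed

section \<open>Evaluation of both permanents at diagonalized quadratic forms\<close>

lemma card_permutes_filter:
  assumes "\<sigma> permutes M"
  shows "card {m \<in> M. P (\<sigma> m)} = card {m \<in> M. P m}"
proof -
  have "\<sigma> ` {m \<in> M. P (\<sigma> m)} = {m \<in> M. P m}"
    using permutes_image[OF assms] permutes_in_image[OF assms] by (auto simp: image_iff)
  moreover have "inj_on \<sigma> {m \<in> M. P (\<sigma> m)}"
    using permutes_inj_on[OF assms] .
  ultimately show ?thesis
    by (metis card_image)
qed

text \<open>The square is a sum over pairs of permutations, and for each colouring pair the two
  permutations are counted independently, giving \<open>(K c d)\<^sup>2\<close>. Its value
  \<open>(fact k * fact (card N - k))\<^sup>2\<close> cancels against the squared binomial, so all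
  monomials get the same weight: the result is a multiple of the complete homogeneous
  polynomial.\<close>

lemma double_permanent_sum_eval:
  fixes u :: "'a \<Rightarrow> real \<times> real" and v :: "'b \<Rightarrow> real \<times> real" and w :: "bool \<Rightarrow> real \<times> real" and l :: "bool \<Rightarrow> real"
  assumes R: "\<And>x y. (\<Sum>t\<in>T. dot x (v t) * dot y (v t)) = (\<Sum>c\<in>UNIV. dot x (w c) * dot y (w c))"
    and Q: "\<And>c d. (\<Sum>s\<in>S. dot (w c) (u s) * dot (w d) (u s)) = (if c = d then l c else 0)"
    and l: "\<And>c. l c \<ge> 0"
    and fin: "finite N" "finite S" "finite T"
  shows "(\<Sum>\<psi>\<in>N \<rightarrow>\<^sub>E S. \<Sum>\<phi>\<in>N \<rightarrow>\<^sub>E T. (\<Sum>\<sigma> | \<sigma> permutes N. \<Prod>i\<in>N. dot (u (\<psi> i)) (v (\<phi> (\<sigma> i))))\<^sup>2) =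
    (fact (card N))\<^sup>2 * (\<Sum>k\<le>card N. l True ^ k * l False ^ (card N - k))"
proof -
  let ?P = "{\<sigma>. \<sigma> permutes N}" and ?B = "N \<rightarrow>\<^sub>E (UNIV :: bool set)"
  define K where "K c d = card {\<sigma>. \<sigma> permutes N \<and> (\<forall>i\<in>N. c (\<sigma> i) = d i)}" for c d :: "'c \<Rightarrow> bool"
  define L where "L d = (\<Prod>j\<in>N. l (d j))" for d
  have finP: "finite ?P"
    using fin(1) by (rule finite_permutations)
  have pair: "(\<Sum>\<psi>\<in>N \<rightarrow>\<^sub>E S. \<Sum>\<phi>\<in>N \<rightarrow>\<^sub>E T.
      (\<Prod>i\<in>N. dot (u (\<psi> i)) (v (\<phi> (\<sigma> i)))) * (\<Prod>i\<in>N. dot (u (\<psi> i)) (v (\<phi> (\<tau> i))))) =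
    (\<Sum>c\<in>?B. \<Sum>d\<in>?B. of_bool (\<forall>i\<in>N. c (\<sigma> i) = d i) * of_bool (\<forall>i\<in>N. c (\<tau> i) = d i) * L d)"
    if \<sigma>: "\<sigma> permutes N" and \<tau>: "\<tau> permutes N" for \<sigma> \<tau>
  proof -
    \<comment> \<open>The factors of the product of two permutation terms are indexed by
      \<open>N \<times> UNIV\<close>; the Boolean tells which permutation a factor belongs
      to.\<close>
    define g where "g m = (if snd m then \<sigma> (fst m) else \<tau> (fst m))" for m
    let ?M = "N \<times> (UNIV :: bool set)"
    have "(\<Prod>i\<in>N. dot (u (\<psi> i)) (v (\<phi> (\<sigma> i)))) * (\<Prod>i\<in>N. dot (u (\<psi> i)) (v (\<phi> (\<tau> i)))) =
      (\<Prod>m\<in>?M. dot (u (\<psi> (fst m))) (v (\<phi> (g m))))" for \<psi> \<phi>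
    proof -
      have "(\<Prod>m\<in>?M. h m) = (\<Prod>i\<in>N. \<Prod>b\<in>UNIV. h (i, b))" for h :: "'c \<times> bool \<Rightarrow> real"
        by (simp add: prod.cartesian_product)
      then show ?thesis
        by (simp add: UNIV_bool g_def prod.distrib mult.commute)
    qed
    moreover have "(\<Sum>\<psi>\<in>N \<rightarrow>\<^sub>E S. \<Sum>\<phi>\<in>N \<rightarrow>\<^sub>E T. \<Prod>m\<in>?M. dot (u (\<psi> (fst m))) (v (\<phi> (g m)))) =
      (\<Sum>c\<in>?B. \<Sum>d\<in>?B. if \<forall>m\<in>?M. c (g m) = d (fst m) then L d else 0)"
      unfolding L_def
    proof (rule double_sum_dot_eq[where f = fst and g = g and M = ?M and N = N, OF R Q l])
      show "g ` ?M \<subseteq> N"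
        by (auto simp: g_def permutes_in_image[OF \<sigma>] permutes_in_image[OF \<tau>])
    next
      fix j assume j: "j \<in> N"
      have "{m \<in> ?M. fst m = j} = {(j, True), (j, False)}"
        using j by (auto simp: prod_eq_iff)
      then show "card {m \<in> ?M. fst m = j} = 2" by simp
      have "j \<in> \<sigma> ` N" "j \<in> \<tau> ` N"
        using j by (simp_all add: permutes_image \<sigma> \<tau>)
      then obtain x y where xy: "x \<in> N" "\<sigma> x = j" "y \<in> N" "\<tau> y = j"
        by auto
      have eq: "\<sigma> i = j \<longleftrightarrow> i = x" "\<tau> i = j \<longleftrightarrow> i = y" for i
        using xy(2,4) inj_eq[OF permutes_inj[OF \<sigma>], of i x] inj_eq[OF permutes_inj[OF \<tau>], of i y] by simp_all
      have fibre: "{m \<in> ?M. g m = j} = {(x, True), (y, False)}"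
      proof (rule equalityI; rule subsetI)
        fix m assume "m \<in> {m \<in> ?M. g m = j}"
        then have "g (fst m, snd m) = j" by simp
        then have "(fst m, snd m) \<in> {(x, True), (y, False)}"
          by (cases "snd m") (simp_all add: g_def eq)
        then show "m \<in> {(x, True), (y, False)}" by simp
      next
        fix m assume "m \<in> {(x, True), (y, False)}"
        then consider "m = (x, True)" | "m = (y, False)" by blast
        then show "m \<in> {m \<in> ?M. g m = j}"
          by cases (simp_all add: g_def xy)
      qed
      show "card {m \<in> ?M. g m = j} = 2"
        unfolding fibre by simp
    qed (use fin in auto)
    moreover have "(\<forall>m\<in>?M. c (g m) = d (fst m)) \<longleftrightarrow> (\<forall>i\<in>N. c (\<sigma> i) = d i) \<and> (\<forall>i\<in>N. c (\<tau> i) = d i)"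
      for c d :: "'c \<Rightarrow> bool"
      by (auto simp: g_def split: if_splits)
    then have "(if \<forall>m\<in>?M. c (g m) = d (fst m) then L d else 0) =
      of_bool (\<forall>i\<in>N. c (\<sigma> i) = d i) * of_bool (\<forall>i\<in>N. c (\<tau> i) = d i) * L d" for c d
      by simp
    ultimately show ?thesis by simp
  qed
  have "(\<Sum>\<psi>\<in>N \<rightarrow>\<^sub>E S. \<Sum>\<phi>\<in>N \<rightarrow>\<^sub>E T. (\<Sum>\<sigma>\<in>?P. \<Prod>i\<in>N. dot (u (\<psi> i)) (v (\<phi> (\<sigma> i))))\<^sup>2) =
    (\<Sum>\<psi>\<in>N \<rightarrow>\<^sub>E S. \<Sum>\<sigma>\<in>?P. \<Sum>\<tau>\<in>?P. \<Sum>\<phi>\<in>N \<rightarrow>\<^sub>E T.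
      (\<Prod>i\<in>N. dot (u (\<psi> i)) (v (\<phi> (\<sigma> i)))) * (\<Prod>i\<in>N. dot (u (\<psi> i)) (v (\<phi> (\<tau> i)))))"
    unfolding power2_eq_square sum_product
    by (intro sum.cong refl, subst sum.swap, intro sum.cong refl, rule sum.swap)
  also have "\<dots> = (\<Sum>\<sigma>\<in>?P. \<Sum>\<tau>\<in>?P. \<Sum>\<psi>\<in>N \<rightarrow>\<^sub>E S. \<Sum>\<phi>\<in>N \<rightarrow>\<^sub>E T.
      (\<Prod>i\<in>N. dot (u (\<psi> i)) (v (\<phi> (\<sigma> i)))) * (\<Prod>i\<in>N. dot (u (\<psi> i)) (v (\<phi> (\<tau> i)))))"
    by (subst sum.swap, intro sum.cong refl, rule sum.swap)
  also have "\<dots> = (\<Sum>\<sigma>\<in>?P. \<Sum>\<tau>\<in>?P. \<Sum>c\<in>?B. \<Sum>d\<in>?B.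
      of_bool (\<forall>i\<in>N. c (\<sigma> i) = d i) * of_bool (\<forall>i\<in>N. c (\<tau> i) = d i) * L d)"
    by (intro sum.cong refl) (simp add: pair)
  also have "\<dots> = (\<Sum>\<sigma>\<in>?P. \<Sum>c\<in>?B. \<Sum>d\<in>?B. \<Sum>\<tau>\<in>?P.
      of_bool (\<forall>i\<in>N. c (\<sigma> i) = d i) * of_bool (\<forall>i\<in>N. c (\<tau> i) = d i) * L d)"
    by (intro sum.cong refl, subst sum.swap, intro sum.cong refl, rule sum.swap)
  also have "\<dots> = (\<Sum>c\<in>?B. \<Sum>d\<in>?B. \<Sum>\<sigma>\<in>?P. \<Sum>\<tau>\<in>?P.
      of_bool (\<forall>i\<in>N. c (\<sigma> i) = d i) * of_bool (\<forall>i\<in>N. c (\<tau> i) = d i) * L d)"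
    by (subst sum.swap, intro sum.cong refl, rule sum.swap)
  also have "\<dots> = (\<Sum>c\<in>?B. \<Sum>d\<in>?B. (real (K c d))\<^sup>2 * L d)"
  proof (intro sum.cong refl)
    fix c d :: "'c \<Rightarrow> bool"
    have K: "real (K c d) = (\<Sum>\<sigma>\<in>?P. of_bool (\<forall>i\<in>N. c (\<sigma> i) = d i))"
      using finP by (simp add: K_def Int_def)
    show "(\<Sum>\<sigma>\<in>?P. \<Sum>\<tau>\<in>?P. of_bool (\<forall>i\<in>N. c (\<sigma> i) = d i) * of_bool (\<forall>i\<in>N. c (\<tau> i) = d i) * L d) = (real (K c d))\<^sup>2 * L d"
      unfolding K power2_eq_square sum_product by (simp only: sum_distrib_right)
  qed
  also have "\<dots> = (\<Sum>c\<in>?B. \<Sum>d\<in>?B. (\<lambda>j k. if j = k then (fact k * fact (card N - k))\<^sup>2 * (l True ^ k * l False ^ (card N - k)) else 0)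
      (card {i \<in> N. c i}) (card {i \<in> N. d i}))"
    by (intro sum.cong refl) (simp add: K_def L_def card_permutes_bool prod_bool_function fin)
  also have "\<dots> = (\<Sum>k\<le>card N. (real (card N choose k))\<^sup>2 * ((fact k * fact (card N - k))\<^sup>2 * (l True ^ k * l False ^ (card N - k))))"
    by (subst sum_bool_pairs[OF fin(1)]) auto
  also have "\<dots> = (\<Sum>k\<le>card N. (fact (card N))\<^sup>2 * (l True ^ k * l False ^ (card N - k)))"
    by (intro sum.cong refl) (simp add: binomial_fact power_divide power_mult_distrib)
  finally show ?thesis
    by (simp add: sum_distrib_left)
qed

lemma card_filter_div_2:
  fixes n :: nat
  shows "card {m \<in> {0..<2 * n}. c (m div 2)} = 2 * card {i \<in> {0..<n}. c i}"
proof -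
  let ?A = "{i \<in> {0..<n}. c i}"
  have "{m \<in> {0..<2 * n}. c (m div 2)} = (\<lambda>i. 2 * i) ` ?A \<union> (\<lambda>i. 2 * i + 1) ` ?A" (is "?L = ?R")
  proof (rule equalityI; rule subsetI)
    fix m assume "m \<in> ?L"
    then have "m div 2 \<in> ?A" "m = 2 * (m div 2) \<or> m = 2 * (m div 2) + 1" by auto
    then show "m \<in> ?R" by blast
  qed auto
  moreover have "card ((\<lambda>i. 2 * i) ` ?A \<union> (\<lambda>i. 2 * i + 1) ` ?A) = card ((\<lambda>i. 2 * i) ` ?A) + card ((\<lambda>i. 2 * i + 1) ` ?A)"
    by (rule card_Un_disjoint) (auto, presburger)
  ultimately show ?thesis
    by (simp add: card_image inj_on_def)
qed

text \<open>Now the repetition of indices is built into \<open>m div 2\<close>, and a single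
  permutation of the doubled set takes the place of a pair. Colour classes have doubled sizes, so
  the count is \<open>fact (2 * k) * fact (2 * n - 2 * k)\<close>, which does not cancel against the
  squared binomial.\<close>

lemma doubled_permanent_sum_eval:
  fixes u :: "'a \<Rightarrow> real \<times> real" and v :: "'b \<Rightarrow> real \<times> real" and w :: "bool \<Rightarrow> real \<times> real" and l :: "bool \<Rightarrow> real"
  assumes R: "\<And>x y. (\<Sum>t\<in>T. dot x (v t) * dot y (v t)) = (\<Sum>c\<in>UNIV. dot x (w c) * dot y (w c))"
    and Q: "\<And>c d. (\<Sum>s\<in>S. dot (w c) (u s) * dot (w d) (u s)) = (if c = d then l c else 0)"
    and l: "\<And>c. l c \<ge> 0"
    and fin: "finite S" "finite T"
  shows "(\<Sum>\<psi>\<in>{0..<n} \<rightarrow>\<^sub>E S. \<Sum>\<phi>\<in>{0..<n} \<rightarrow>\<^sub>E T.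
      \<Sum>\<rho> | \<rho> permutes {0..<2 * n}. \<Prod>m\<in>{0..<2 * n}. dot (u (\<psi> (m div 2))) (v (\<phi> (\<rho> m div 2)))) =
    (\<Sum>k\<le>n. (real (n choose k))\<^sup>2 * (fact (2 * k) * fact (2 * n - 2 * k)) * (l True ^ k * l False ^ (n - k)))"
proof -
  let ?M = "{0..<2 * n}" and ?N = "{0..<n}"
  let ?P = "{\<rho>. \<rho> permutes ?M}" and ?B = "?N \<rightarrow>\<^sub>E (UNIV :: bool set)"
  define K where "K c d = card {\<rho>. \<rho> permutes ?M \<and> (\<forall>m\<in>?M. c (\<rho> m div 2) = d (m div 2))}" for c d :: "nat \<Rightarrow> bool"
  define L where "L d = (\<Prod>j\<in>?N. l (d j))" for d
  have finP: "finite ?P"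
    by (rule finite_permutations) simp
  have fibre: "card {m \<in> ?M. m div 2 = j} = 2" if "j \<in> ?N" for j
  proof -
    have "{i \<in> ?N. i = j} = {j}"
      using that by auto
    then show ?thesis
      using card_filter_div_2[of n "\<lambda>i. i = j"] by simp
  qed
  have single: "(\<Sum>\<psi>\<in>?N \<rightarrow>\<^sub>E S. \<Sum>\<phi>\<in>?N \<rightarrow>\<^sub>E T. \<Prod>m\<in>?M. dot (u (\<psi> (m div 2))) (v (\<phi> (\<rho> m div 2)))) =
      (\<Sum>c\<in>?B. \<Sum>d\<in>?B. if \<forall>m\<in>?M. c (\<rho> m div 2) = d (m div 2) then L d else 0)"
    if \<rho>: "\<rho> permutes ?M" for \<rho>
    unfolding L_def
  proof (rule double_sum_dot_eq[where f = "\<lambda>m. m div 2" and g = "\<lambda>m. \<rho> m div 2" and M = ?M and N = ?N, OF R Q l])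
    fix j assume "j \<in> ?N"
    then show "card {m \<in> ?M. m div 2 = j} = 2" "card {m \<in> ?M. \<rho> m div 2 = j} = 2"
      using fibre card_permutes_filter[OF \<rho>, of "\<lambda>m. m div 2 = j"] by simp_all
  next
    show "(\<lambda>m. m div 2) ` ?M \<subseteq> ?N" by auto
    show "(\<lambda>m. \<rho> m div 2) ` ?M \<subseteq> ?N"
    proof
      fix j assume "j \<in> (\<lambda>m. \<rho> m div 2) ` ?M"
      then obtain m where m: "m \<in> ?M" "j = \<rho> m div 2" by blast
      then have "\<rho> m \<in> ?M"
        using permutes_in_image[OF \<rho>] by blast
      with m(2) show "j \<in> ?N" by auto
    qed
  qed (use fin in simp_all)
  have "(\<Sum>\<psi>\<in>?N \<rightarrow>\<^sub>E S. \<Sum>\<phi>\<in>?N \<rightarrow>\<^sub>E T. \<Sum>\<rho>\<in>?P. \<Prod>m\<in>?M. dot (u (\<psi> (m div 2))) (v (\<phi> (\<rho> m div 2)))) =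
    (\<Sum>\<psi>\<in>?N \<rightarrow>\<^sub>E S. \<Sum>\<rho>\<in>?P. \<Sum>\<phi>\<in>?N \<rightarrow>\<^sub>E T. \<Prod>m\<in>?M. dot (u (\<psi> (m div 2))) (v (\<phi> (\<rho> m div 2))))"
    by (intro sum.cong refl, rule sum.swap)
  also have "\<dots> = (\<Sum>\<rho>\<in>?P. \<Sum>\<psi>\<in>?N \<rightarrow>\<^sub>E S. \<Sum>\<phi>\<in>?N \<rightarrow>\<^sub>E T. \<Prod>m\<in>?M. dot (u (\<psi> (m div 2))) (v (\<phi> (\<rho> m div 2))))"
    by (rule sum.swap)
  also have "\<dots> = (\<Sum>\<rho>\<in>?P. \<Sum>c\<in>?B. \<Sum>d\<in>?B. if \<forall>m\<in>?M. c (\<rho> m div 2) = d (m div 2) then L d else 0)"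
    by (intro sum.cong refl) (use single in blast)
  also have "\<dots> = (\<Sum>c\<in>?B. \<Sum>d\<in>?B. \<Sum>\<rho>\<in>?P. if \<forall>m\<in>?M. c (\<rho> m div 2) = d (m div 2) then L d else 0)"
    by (subst sum.swap, intro sum.cong refl, rule sum.swap)
  also have "\<dots> = (\<Sum>c\<in>?B. \<Sum>d\<in>?B. K c d * L d)"
    using finP by (intro sum.cong refl) (simp add: K_def sum.If_cases Int_def)
  also have "\<dots> = (\<Sum>c\<in>?B. \<Sum>d\<in>?B. (\<lambda>j k. if j = k then (fact (2 * k) * fact (2 * n - 2 * k)) * (l True ^ k * l False ^ (n - k)) else 0)
      (card {i \<in> ?N. c i}) (card {i \<in> ?N. d i}))"
  proof (intro sum.cong refl)
    fix c d :: "nat \<Rightarrow> bool"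
    show "K c d * L d = (\<lambda>j k. if j = k then (fact (2 * k) * fact (2 * n - 2 * k)) * (l True ^ k * l False ^ (n - k)) else 0)
      (card {i \<in> ?N. c i}) (card {i \<in> ?N. d i})"
      using card_permutes_bool[of ?M "\<lambda>m. c (m div 2)" "\<lambda>m. d (m div 2)"] prod_bool_function[of ?N l d]
      unfolding K_def L_def card_filter_div_2 by simp
  qed
  also have "\<dots> = (\<Sum>k\<le>n. (real (n choose k))\<^sup>2 * ((fact (2 * k) * fact (2 * n - 2 * k)) * (l True ^ k * l False ^ (n - k))))"
    by (subst sum_bool_pairs) auto
  finally show ?thesis
    by (simp add: mult.assoc)
qed

section \<open>Legendre and Chebyshev polynomials\<close>

text \<open>For \<open>x = exp(i\<theta>)\<close> and \<open>y = exp(-i\<theta>)\<close> the sum of \<open>legendre_coeff n j * (x ^ j * y ^ (n - j))\<close> over \<open>j\<close>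
  is \<open>4 ^ n / (2 * n choose n)\<close> times the Legendre polynomial \<open>P\<^sub>n\<close> at \<open>cos \<theta>\<close>.\<close>

definition legendre_coeff :: "nat \<Rightarrow> nat \<Rightarrow> real" where
  "legendre_coeff n j = (real (n choose j))\<^sup>2 / real (2 * n choose (2 * j))"

text \<open>With \<open>i = k - 1\<close>, \<open>m = n - k\<close> and \<open>r = n - 2 * k\<close>
  all factorials reduce to a common factor \<open>F\<close>. The rest is the difference of
  \<open>2 * (2 * x + 1) / (x + 1) = 4 - 2 / (x + 1)\<close> at \<open>m\<close> and at
  \<open>i\<close>, where \<open>m - i = r + 1\<close>; this is the source of the factor
  \<open>n - 2 * k + 1\<close> in \<open>coeff_C\<close>.\<close>

lemma legendre_coeff_diff:
  assumes "1 \<le> k" "2 * k \<le> n"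
  shows "legendre_coeff n (k - 1) - legendre_coeff n k =
    coeff_C n k * (fact n)\<^sup>2 / ((fact (n - 2 * k))\<^sup>2 * (fact k)\<^sup>2)"
proof -
  obtain i where k: "k = Suc i"
    using assms(1) by (cases k) auto
  obtain r where n: "n = 2 * i + 2 + r"
    using assms(2) k by (metis le_iff_add mult_Suc_right add.commute)
  define m where "m = i + 1 + r"
  have n': "n = m + Suc i"
    using n by (simp add: m_def)
  have a: "fact (2 * k) = (2 * real i + 2) * (2 * real i + 1) * fact (2 * i)"
    "fact (2 * n - 2 * i) = (2 * real m + 2) * (2 * real m + 1) * fact (2 * m)"
    "fact k = (real i + 1) * fact i"
    "fact (n - i) = (real m + 1) * fact m"
    "fact (n - 2 * k + 1) = (real r + 1) * fact r"
    "2 * n - 2 * k = 2 * m" "n - k = m" "n - 2 * k = r" "k - 1 = i" "n - k + 1 = Suc m"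
    "fact (Suc m) = (real m + 1) * fact m"
  proof -
    show "2 * n - 2 * k = 2 * m" "n - k = m" "n - 2 * k = r" "k - 1 = i" "n - k + 1 = Suc m"
      unfolding k n' by (simp_all add: m_def)
    then show "fact (n - 2 * k + 1) = (real r + 1) * fact r" by simp
    have "2 * k = Suc (Suc (2 * i))" "2 * n - 2 * i = Suc (Suc (2 * m))" "n - i = Suc m"
      unfolding k n' by simp_all
    then show "fact (2 * k) = (2 * real i + 2) * (2 * real i + 1) * fact (2 * i)"
      "fact (2 * n - 2 * i) = (2 * real m + 2) * (2 * real m + 1) * fact (2 * m)"
      "fact (n - i) = (real m + 1) * fact m"
      by (simp_all add: algebra_simps)
    show "fact k = (real i + 1) * fact i" "fact (Suc m) = (real m + 1) * fact m"
      unfolding k by simp_all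
  qed
  have b: "real (n choose j) = fact n / (fact j * fact (n - j))"
    "real (2 * n choose (2 * j)) = fact (2 * n) / (fact (2 * j) * fact (2 * n - 2 * j))" if "j \<le> n" for j
    using that by (simp_all add: binomial_fact)
  have le: "i \<le> n" "k \<le> n"
    using assms k by auto
  define F where "F = fact (2 * i) * fact (2 * m) * (fact n)\<^sup>2 / (fact (2 * n) * (fact i)\<^sup>2 * (fact m)\<^sup>2 :: real)"
  have e1: "legendre_coeff n i = F * ((2 * real m + 2) * (2 * real m + 1) / (real m + 1)\<^sup>2)"
    unfolding legendre_coeff_def b(1)[OF le(1)] b(2)[OF le(1)] a F_def by (simp add: field_simps power2_eq_square)
  have e2: "legendre_coeff n k = F * ((2 * real i + 2) * (2 * real i + 1) / (real i + 1)\<^sup>2)"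
    unfolding legendre_coeff_def b(1)[OF le(2)] b(2)[OF le(2)] a F_def by (simp add: field_simps power2_eq_square)
  have e3: "coeff_C n k * (fact n)\<^sup>2 / ((fact (n - 2 * k))\<^sup>2 * (fact k)\<^sup>2) =
    F * ((2 * real i + 2) * (real r + 1) / ((real m + 1) * (real i + 1)\<^sup>2))"
  proof -
    have k2: "2 * real k - 1 = 2 * real i + 1"
      by (simp add: k)
    have nz: "2 * real i + 1 \<noteq> 0" by linarith
    show ?thesis
      unfolding coeff_C_def k2 a F_def using nz
      by (simp add: divide_simps power2_eq_square) (simp add: algebra_simps)
  qed
  have e4: "(2 * real m + 2) * (2 * real m + 1) / (real m + 1)\<^sup>2 - (2 * real i + 2) * (2 * real i + 1) / (real i + 1)\<^sup>2
    = (2 * real i + 2) * (real r + 1) / ((real m + 1) * (real i + 1)\<^sup>2)"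
  proof -
    have "real m = real i + 1 + real r"
      by (simp add: m_def)
    moreover have "real m + 1 \<noteq> 0" "real i + 1 \<noteq> 0" by linarith+
    moreover have "(2 * x + 2) * (2 * x + 1) / (x + 1)\<^sup>2 - (2 * y + 2) * (2 * y + 1) / (y + 1)\<^sup>2
      = (2 * y + 2) * (z + 1) / ((x + 1) * (y + 1)\<^sup>2)"
      if "x = y + 1 + z" "x + 1 \<noteq> 0" "y + 1 \<noteq> 0" for x y z :: real
    proof -
      have "(2 * x + 2) * (2 * x + 1) / (x + 1)\<^sup>2 = 2 * (2 * x + 1) / (x + 1)"
        "(2 * y + 2) * (2 * y + 1) / (y + 1)\<^sup>2 = 2 * (2 * y + 1) / (y + 1)"
        "(2 * y + 2) * (z + 1) / ((x + 1) * (y + 1)\<^sup>2) = 2 * (z + 1) / ((x + 1) * (y + 1))"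
        using that by (simp_all add: divide_simps power2_eq_square) (simp_all add: algebra_simps)
      moreover have "2 * (2 * x + 1) / (x + 1) - 2 * (2 * y + 1) / (y + 1) = 2 * (z + 1) / ((x + 1) * (y + 1))"
        using that(2,3) by (simp add: divide_simps) (simp add: that(1) algebra_simps)
      ultimately show ?thesis by simp
    qed
    ultimately show ?thesis by blast
  qed
  show ?thesis
    unfolding a(9) e1 e2 e3 e4[symmetric] right_diff_distrib ..
qed

text \<open>The product of \<open>(x * y) ^ k\<close> with the inner sum consists of the monomials
  \<open>x ^ j * y ^ (n - j)\<close> with \<open>k \<le> j \<le> n - k\<close>. So the monomial at
  \<open>j\<close> collects the differences for \<open>k\<close> up to \<open>min j (n - j)\<close>;
  they telescope, and the symmetry of the coefficients turns the result into
  \<open>1 - legendre_coeff n j\<close>.\<close>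

lemma sum_geometric_minus_legendre:
  fixes x y :: real
  shows "(\<Sum>j\<le>n. x ^ j * y ^ (n - j)) - (\<Sum>j\<le>n. legendre_coeff n j * (x ^ j * y ^ (n - j))) =
    (\<Sum>k = 1..n div 2. (legendre_coeff n (k - 1) - legendre_coeff n k) *
      ((x * y) ^ k * (\<Sum>j\<le>n - 2 * k. x ^ j * y ^ (n - 2 * k - j))))"
proof -
  let ?b = "legendre_coeff n"
  have shift: "(x * y) ^ k * (\<Sum>j\<le>n - 2 * k. x ^ j * y ^ (n - 2 * k - j)) =
      (\<Sum>j\<le>n. if k \<le> j \<and> k \<le> n - j then x ^ j * y ^ (n - j) else 0)" if "2 * k \<le> n" for k
  proof -
    have "(x * y) ^ k * (\<Sum>j\<le>n - 2 * k. x ^ j * y ^ (n - 2 * k - j)) =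
        (\<Sum>j\<in>{0..n - 2 * k}. x ^ (j + k) * y ^ (n - (j + k)))"
      unfolding sum_distrib_left atMost_atLeast0
    proof (intro sum.cong refl)
      fix j assume "j \<in> {0..n - 2 * k}"
      then have "n - (j + k) = k + (n - 2 * k - j)"
        using that by auto
      then show "(x * y) ^ k * (x ^ j * y ^ (n - 2 * k - j)) = x ^ (j + k) * y ^ (n - (j + k))"
        by (simp add: power_add power_mult_distrib)
    qed
    also have "\<dots> = (\<Sum>j\<in>{0 + k..n - 2 * k + k}. x ^ j * y ^ (n - j))"
      by (rule sum.shift_bounds_cl_nat_ivl[symmetric])
    also have "\<dots> = (\<Sum>j\<le>n. if k \<le> j \<and> k \<le> n - j then x ^ j * y ^ (n - j) else 0)"
      using that by (subst sum.inter_filter[symmetric], simp) (rule sum.cong, auto)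
    finally show ?thesis .
  qed
  have telescope: "(\<Sum>k = 1..m. ?b (k - 1) - ?b k) = ?b 0 - ?b m" for m
    by (induction m) auto
  have b0: "?b 0 = 1"
    by (simp add: legendre_coeff_def)
  have bmin: "?b (min j (n - j)) = ?b j" if "j \<le> n" for j
  proof -
    have "2 * n - 2 * j = 2 * (n - j)" by simp
    then have "?b (n - j) = ?b j"
      unfolding legendre_coeff_def
      using binomial_symmetric[OF that] binomial_symmetric[of "2 * j" "2 * n"] that by simp
    then show ?thesis by (simp add: min_def)
  qed
  have "(\<Sum>k = 1..n div 2. (?b (k - 1) - ?b k) * ((x * y) ^ k * (\<Sum>j\<le>n - 2 * k. x ^ j * y ^ (n - 2 * k - j)))) =
    (\<Sum>k = 1..n div 2. \<Sum>j\<le>n. if k \<le> j \<and> k \<le> n - j then (?b (k - 1) - ?b k) * (x ^ j * y ^ (n - j)) else 0)"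
  proof (intro sum.cong refl)
    fix k assume "k \<in> {1..n div 2}"
    then have "2 * k \<le> n" by auto
    show "(?b (k - 1) - ?b k) * ((x * y) ^ k * (\<Sum>j\<le>n - 2 * k. x ^ j * y ^ (n - 2 * k - j))) =
      (\<Sum>j\<le>n. if k \<le> j \<and> k \<le> n - j then (?b (k - 1) - ?b k) * (x ^ j * y ^ (n - j)) else 0)"
      unfolding shift[OF \<open>2 * k \<le> n\<close>]
      by (subst sum_distrib_left) (auto intro!: sum.cong)
  qed
  also have "\<dots> = (\<Sum>j\<le>n. \<Sum>k = 1..n div 2. if k \<le> j \<and> k \<le> n - j then (?b (k - 1) - ?b k) * (x ^ j * y ^ (n - j)) else 0)"
    by (rule sum.swap)
  also have "\<dots> = (\<Sum>j\<le>n. (1 - ?b j) * (x ^ j * y ^ (n - j)))"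
  proof (intro sum.cong refl)
    fix j assume j: "j \<in> {..n}"
    \<comment> \<open>The bound \<open>min j (n - j)\<close> never exceeds \<open>n div 2\<close>,
      so the condition alone cuts off the range.\<close>
    have "(\<Sum>k = 1..n div 2. if k \<le> j \<and> k \<le> n - j then (?b (k - 1) - ?b k) * (x ^ j * y ^ (n - j)) else 0) =
      (\<Sum>k = 1..min j (n - j). (?b (k - 1) - ?b k) * (x ^ j * y ^ (n - j)))"
      by (subst sum.inter_filter[symmetric], simp) (rule sum.cong, use j in auto)
    also have "\<dots> = (1 - ?b j) * (x ^ j * y ^ (n - j))"
      unfolding sum_distrib_right[symmetric] telescope b0 using bmin j by simp
    finally show "(\<Sum>k = 1..n div 2. if k \<le> j \<and> k \<le> n - j then (?b (k - 1) - ?b k) * (x ^ j * y ^ (n - j)) else 0) =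
      (1 - ?b j) * (x ^ j * y ^ (n - j))" .
  qed
  also have "\<dots> = (\<Sum>j\<le>n. x ^ j * y ^ (n - j)) - (\<Sum>j\<le>n. ?b j * (x ^ j * y ^ (n - j)))"
    by (simp add: left_diff_distrib sum_subtractf)
  finally show ?thesis ..
qed

section \<open>Matching sums\<close>

definition row_vec :: "real mat \<Rightarrow> nat \<Rightarrow> real \<times> real" where
  "row_vec U i = (U $$ (i, 0), U $$ (i, 1))"

lemma edge_weight_row_vec:
  assumes "dim_col U = 2"
  shows "edge_weight U {i, j} =
    (fst (row_vec U i) * snd (row_vec U j) - snd (row_vec U i) * fst (row_vec U j))\<^sup>2"
  using assms by (simp add: edge_weight_doubleton pair_det_eq row_vec_def row_def)

text \<open>The set function whose zeta transform is \<open>det Q\<close>. The case distinction is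
  needed because \<open>edge_weight\<close> also assigns values to sets that are not edges.\<close>

definition edge_coeff :: "real mat \<Rightarrow> nat set \<Rightarrow> real" where
  "edge_coeff U e = (if card e = 2 then edge_weight U e else 0)"

text \<open>Lagrange's identity over unordered pairs. A new element \<open>x\<close> adds the terms
  \<open>c x j\<close> once as a row and once as a column, while among the new subsets only
  \<open>{x, j}\<close> with \<open>j \<in> S\<close> carry weight.\<close>

lemma gram_det_zeta:
  assumes "finite S" "dim_col U = 2"
  shows "gram_det (row_vec U) S = (\<Sum>e\<in>Pow S. edge_coeff U e)"
proof -
  define c where "c i j = (fst (row_vec U i) * snd (row_vec U j) - snd (row_vec U i) * fst (row_vec U j))\<^sup>2" for i j
  have c: "c i j = c j i" "c i i = 0" "edge_weight U {i, j} = c i j" for i j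
    using edge_weight_row_vec[OF assms(2)] by (simp_all add: c_def power2_commute[of "fst (row_vec U i) * snd (row_vec U j)"] mult.commute)
  have "(\<Sum>i\<in>S. \<Sum>j\<in>S. c i j) = 2 * (\<Sum>e\<in>Pow S. edge_coeff U e)"
    using assms(1)
  proof (induction S rule: finite_induct)
    case empty
    show ?case by (simp add: edge_coeff_def)
  next
    case (insert x S)
    have "(\<Sum>e\<in>Pow (insert x S). edge_coeff U e) = (\<Sum>e\<in>Pow S. edge_coeff U e) + (\<Sum>e\<in>insert x ` Pow S. edge_coeff U e)"
      unfolding Pow_insert using insert.hyps by (intro sum.union_disjoint) auto
    also have "(\<Sum>e\<in>insert x ` Pow S. edge_coeff U e) = (\<Sum>e\<in>Pow S. edge_coeff U (insert x e))"
      using insert.hyps by (subst sum.reindex) (auto simp: inj_on_def)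
    also have "\<dots> = (\<Sum>e\<in>(\<lambda>j. {j}) ` S. edge_coeff U (insert x e))"
    proof (rule sum.mono_neutral_right)
      show "\<forall>e\<in>Pow S - (\<lambda>j. {j}) ` S. edge_coeff U (insert x e) = 0"
      proof
        fix e assume e: "e \<in> Pow S - (\<lambda>j. {j}) ` S"
        then have "finite e" "x \<notin> e"
          using insert.hyps finite_subset by auto
        moreover have "card e \<noteq> 1"
          using e by (auto simp: card_1_singleton_iff)
        ultimately show "edge_coeff U (insert x e) = 0"
          by (simp add: edge_coeff_def)
      qed
    qed (use insert.hyps in auto)
    also have "\<dots> = (\<Sum>j\<in>S. c x j)"
    proof (subst sum.reindex)
      show "sum ((\<lambda>e. edge_coeff U (insert x e)) \<circ> (\<lambda>j. {j})) S = (\<Sum>j\<in>S. c x j)"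
      proof (rule sum.cong[OF refl])
        fix j assume "j \<in> S"
        with insert.hyps have "x \<noteq> j" by auto
        then show "((\<lambda>e. edge_coeff U (insert x e)) \<circ> (\<lambda>j. {j})) j = c x j"
          by (simp add: edge_coeff_def c(3))
      qed
    qed simp
    finally have "(\<Sum>e\<in>Pow (insert x S). edge_coeff U e) = (\<Sum>e\<in>Pow S. edge_coeff U e) + (\<Sum>j\<in>S. c x j)" .
    moreover have "(\<Sum>i\<in>S. c i x) = (\<Sum>j\<in>S. c x j)"
      by (intro sum.cong refl c(1))
    ultimately show ?case
      using insert by (simp add: sum.distrib c(2))
  qed
  then show ?thesis
    using double_gram_det[of "row_vec U" S] by (simp add: c_def)
qed

section \<open>Recursion for matching sums by removing an edge\<close>

lemma perfect_matchings_remove: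
  assumes "M \<in> perfect_matchings C" "e \<in> M"
  shows "M - {e} \<in> perfect_matchings (C - e)" and "e \<subseteq> C" and "card e = 2"
proof -
  have "partition_on C M" "\<forall>e\<in>M. card e = 2"
    using assms(1) by (auto simp: perfect_matchings_def)
  moreover from this have "\<Union>M = C" "disjoint M" "{} \<notin> M"
    by (auto simp: partition_on_def)
  moreover from this have "\<Union>(M - {e}) = C - e"
    using assms(2) by (auto simp: disjoint_def)
  ultimately show "M - {e} \<in> perfect_matchings (C - e)" "e \<subseteq> C" "card e = 2"
    using assms(2) by (auto simp: perfect_matchings_def partition_on_def disjoint_def)
qed

lemma perfect_matchings_insert:
  assumes "M \<in> perfect_matchings (C - e)" "e \<subseteq> C" "card e = 2"
  shows "insert e M \<in> perfect_matchings C" and "e \<notin> M"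
proof -
  have M: "\<Union>M = C - e" "disjoint M" "{} \<notin> M" "\<forall>e\<in>M. card e = 2"
    using assms(1) by (auto simp: perfect_matchings_def partition_on_def)
  have ne: "e \<noteq> {}"
    using assms(3) by auto
  show "e \<notin> M"
    using M(1) ne by blast
  have "disjoint (insert e M)"
    using M(1,2) by (auto simp: disjoint_def)
  then show "insert e M \<in> perfect_matchings C"
    using M ne assms(2,3) by (auto simp: perfect_matchings_def partition_on_def)
qed

lemma finite_perfect_matchings: "finite C \<Longrightarrow> finite (perfect_matchings C)"
  by (rule finite_subset[of _ "Pow (Pow C)"]) (auto simp: perfect_matchings_def partition_on_def)

lemma card_perfect_matching:
  assumes "finite C" "M \<in> perfect_matchings C"
  shows "finite M" and "card C = 2 * card M"
proof -
  have M: "\<Union>M = C" "disjoint M" "\<forall>e\<in>M. card e = 2"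
    using assms(2) by (auto simp: perfect_matchings_def partition_on_def)
  show "finite M"
    using M(1) assms(1) finite_UnionD by blast
  have "card (\<Union>M) = (\<Sum>e\<in>M. card e)"
    using M by (intro card_Union_disjoint) (auto simp: disjoint_def pairwise_def disjnt_def intro: card_ge_0_finite)
  then show "card C = 2 * card M"
    using M by simp
qed

text \<open>Double counting of pairs of a perfect matching and one of its edges: a matching of
  \<open>C\<close> has \<open>k\<close> edges, and deleting \<open>e\<close> leaves a perfect
  matching of \<open>C - e\<close>.\<close>

lemma sum_edge_weight_Delta:
  assumes "finite C" "card C = 2 * k"
  shows "(\<Sum>e | e \<subseteq> C \<and> card e = 2. edge_weight U e * Delta U (C - e)) = of_nat k * Delta U C"
proof -
  have "of_nat k * Delta U C = (\<Sum>M\<in>perfect_matchings C. \<Sum>e\<in>M. \<Prod>e\<in>M. edge_weight U e)"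
  proof -
    have "card M = k" if "M \<in> perfect_matchings C" for M
      using card_perfect_matching[OF assms(1) that] assms(2) by simp
    then show ?thesis
      unfolding Delta_def sum_distrib_left by (intro sum.cong) simp_all
  qed
  also have "\<dots> = (\<Sum>(M, e)\<in>Sigma (perfect_matchings C) (\<lambda>M. M). \<Prod>e\<in>M. edge_weight U e)"
    by (rule sum.Sigma) (use assms finite_perfect_matchings card_perfect_matching(1) in blast)+
  also have "\<dots> = (\<Sum>(e, M)\<in>Sigma {e. e \<subseteq> C \<and> card e = 2} (\<lambda>e. perfect_matchings (C - e)).
      edge_weight U e * (\<Prod>e\<in>M. edge_weight U e))"
  proof (rule sum.reindex_bij_witness[where i = "\<lambda>(e, M). (insert e M, e)" and j = "\<lambda>(M, e). (e, M - {e})"])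
    fix a assume a: "a \<in> Sigma (perfect_matchings C) (\<lambda>M. M)"
    then show "(\<lambda>(e, M). (insert e M, e)) ((\<lambda>(M, e). (e, M - {e})) a) = a"
      by auto
    show "(\<lambda>(M, e). (e, M - {e})) a \<in> Sigma {e. e \<subseteq> C \<and> card e = 2} (\<lambda>e. perfect_matchings (C - e))"
      using a perfect_matchings_remove[of "fst a" C "snd a"] by auto
    show "(case (case a of (M, e) \<Rightarrow> (e, M - {e})) of (e, M) \<Rightarrow> edge_weight U e * (\<Prod>e\<in>M. edge_weight U e)) =
      (case a of (M, e) \<Rightarrow> \<Prod>e\<in>M. edge_weight U e)"
      using a card_perfect_matching(1)[OF assms(1)] by (auto simp: prod.remove)
  next
    fix b assume b: "b \<in> Sigma {e. e \<subseteq> C \<and> card e = 2} (\<lambda>e. perfect_matchings (C - e))"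
    then show "(\<lambda>(M, e). (e, M - {e})) ((\<lambda>(e, M). (insert e M, e)) b) = b"
      using perfect_matchings_insert(2) by fastforce
    show "(\<lambda>(e, M). (insert e M, e)) b \<in> Sigma (perfect_matchings C) (\<lambda>M. M)"
      using b perfect_matchings_insert(1) by auto
  qed
  also have "\<dots> = (\<Sum>e | e \<subseteq> C \<and> card e = 2. \<Sum>M\<in>perfect_matchings (C - e). edge_weight U e * (\<Prod>e\<in>M. edge_weight U e))"
    by (rule sum.Sigma[symmetric]) (use assms(1) finite_perfect_matchings in auto)
  also have "\<dots> = (\<Sum>e | e \<subseteq> C \<and> card e = 2. edge_weight U e * Delta U (C - e))"
    by (simp add: Delta_def sum_distrib_left)
  finally show ?thesis ..
qed

text \<open>The \<open>k\<close>-th power of \<open>edge_coeff\<close> under the covering product,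
  whose unit is the indicator of the empty set.\<close>

primrec matching_coeff :: "real mat \<Rightarrow> nat \<Rightarrow> nat set \<Rightarrow> real" where
  "matching_coeff U 0 = (\<lambda>A. of_bool (A = {}))"
| "matching_coeff U (Suc k) = union_conv (edge_coeff U) (matching_coeff U k)"

lemma gram_det_power_zeta:
  assumes "finite S" "dim_col U = 2"
  shows "gram_det (row_vec U) S ^ k = (\<Sum>A\<in>Pow S. matching_coeff U k A)"
proof (induction k)
  case 0
  show ?case
    using assms(1) by (simp add: of_bool_def sum.delta)
next
  case (Suc k)
  then show ?case
    using zeta_mult[OF assms(1), of "edge_coeff U" "matching_coeff U k"] gram_det_zeta[OF assms] by simp
qed

lemma matching_coeff_eq_0: "finite A \<Longrightarrow> 2 * k < card A \<Longrightarrow> matching_coeff U k A = 0"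
proof (induction k arbitrary: A)
  case (Suc k)
  have "matching_coeff U k B = 0" if "B \<subseteq> A" "2 * k < card B" for B
    using Suc finite_subset that by blast
  then show ?case
    unfolding matching_coeff.simps
    by (intro union_conv_degree(1)[where p = 2 and q = "2 * k"])
      (use Suc.prems in \<open>auto simp: edge_coeff_def\<close>)
qed auto

text \<open>On \<open>2 * k\<close> points, \<open>k\<close> edges can only cover everything if they
  are disjoint, so the power sums over perfect matchings with ordered edges; \<open>fact k\<close>
  counts the orders.\<close>

lemma matching_coeff_eq_Delta: "finite A \<Longrightarrow> card A = 2 * k \<Longrightarrow> matching_coeff U k A = fact k * Delta U A"
proof (induction k arbitrary: A)
  case 0
  then show ?case by (simp add: Delta_empty)
next
  case (Suc k)
  have "matching_coeff U k B = 0" if "B \<subseteq> A" "2 * k < card B" for B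
    using Suc.prems matching_coeff_eq_0 finite_subset that by blast
  then have "matching_coeff U (Suc k) A = (\<Sum>e | e \<subseteq> A \<and> card e = 2. edge_coeff U e * matching_coeff U k (A - e))"
    unfolding matching_coeff.simps
    by (intro union_conv_degree(2)[where q = "2 * k"])
      (use Suc.prems in \<open>auto simp: edge_coeff_def\<close>)
  also have "\<dots> = (\<Sum>e | e \<subseteq> A \<and> card e = 2. fact k * (edge_weight U e * Delta U (A - e)))"
  proof (intro sum.cong refl)
    fix e assume "e \<in> {e. e \<subseteq> A \<and> card e = 2}"
    then have e: "e \<subseteq> A" "card e = 2" "finite e"
      using Suc.prems finite_subset by auto
    then have "card (A - e) = 2 * k"
      using Suc.prems by (simp add: card_Diff_subset)
    then show "edge_coeff U e * matching_coeff U k (A - e) = fact k * (edge_weight U e * Delta U (A - e))"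
      using Suc.IH Suc.prems e by (simp add: edge_coeff_def)
  qed
  also have "\<dots> = fact (Suc k) * Delta U A"
    unfolding sum_distrib_left[symmetric] sum_edge_weight_Delta[OF Suc.prems] by (simp add: algebra_simps)
  finally show ?case .
qed

section \<open>The permanent identity\<close>

definition onto_maps :: "nat \<Rightarrow> nat set \<Rightarrow> (nat \<Rightarrow> nat) set" where
  "onto_maps m A = {\<psi>. \<psi> \<in> extensional {0..<m} \<and> \<psi> ` {0..<m} = A}"

lemma onto_maps_empty:
  assumes "m < card A"
  shows "onto_maps m A = {}"
proof (rule equals0I)
  fix \<psi> assume "\<psi> \<in> onto_maps m A"
  then have "card A \<le> card {0..<m}"
    using card_image_le[of "{0..<m}" \<psi>] by (simp add: onto_maps_def)
  with assms show False by simp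
qed

lemma card_onto_maps: "finite A \<Longrightarrow> card A = m \<Longrightarrow> card (onto_maps m A) = fact m"
  using card_extensional_onto[of "{0..<m}" A] by (simp add: onto_maps_def)

lemma onto_maps_bij_betw: "\<psi> \<in> onto_maps m A \<Longrightarrow> card A = m \<Longrightarrow> bij_betw \<psi> {0..<m} A"
  by (auto simp: onto_maps_def bij_betw_def intro: eq_card_imp_inj_on)

lemma double_zeta:
  fixes h :: "(nat \<Rightarrow> nat) \<Rightarrow> (nat \<Rightarrow> nat) \<Rightarrow> real"
  assumes "finite S" "finite T"
  shows "(\<Sum>\<psi>\<in>{0..<m} \<rightarrow>\<^sub>E S. \<Sum>\<phi>\<in>{0..<m} \<rightarrow>\<^sub>E T. h \<psi> \<phi>) =
    (\<Sum>A\<in>Pow S. \<Sum>B\<in>Pow T. \<Sum>\<psi>\<in>onto_maps m A. \<Sum>\<phi>\<in>onto_maps m B. h \<psi> \<phi>)"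
proof -
  have "(\<Sum>\<psi>\<in>{0..<m} \<rightarrow>\<^sub>E S. \<Sum>\<phi>\<in>{0..<m} \<rightarrow>\<^sub>E T. h \<psi> \<phi>) =
    (\<Sum>A\<in>Pow S. \<Sum>\<psi>\<in>onto_maps m A. \<Sum>B\<in>Pow T. \<Sum>\<phi>\<in>onto_maps m B. h \<psi> \<phi>)"
    unfolding onto_maps_def by (simp add: sum_PiE_by_range assms)
  also have "\<dots> = (\<Sum>A\<in>Pow S. \<Sum>B\<in>Pow T. \<Sum>\<psi>\<in>onto_maps m A. \<Sum>\<phi>\<in>onto_maps m B. h \<psi> \<phi>)"
    by (intro sum.cong refl) (rule sum.swap)
  finally show ?thesis .
qed

text \<open>One-variable uniqueness used twice: for fixed \<open>T\<close> in the first argument,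
  then in the second argument at \<open>I\<close>.\<close>

lemma double_zeta_unique:
  fixes f g :: "'a set \<Rightarrow> 'b set \<Rightarrow> real"
  assumes "finite I" "finite J"
    and "\<And>S T. S \<subseteq> I \<Longrightarrow> T \<subseteq> J \<Longrightarrow> (\<Sum>A\<in>Pow S. \<Sum>B\<in>Pow T. f A B) = (\<Sum>A\<in>Pow S. \<Sum>B\<in>Pow T. g A B)"
  shows "f I J = g I J"
proof (rule zeta_unique[OF assms(2)])
  fix T assume "T \<subseteq> J"
  then show "(\<Sum>B\<in>Pow T. f I B) = (\<Sum>B\<in>Pow T. g I B)"
    using zeta_unique[OF assms(1), of "\<lambda>A. \<Sum>B\<in>Pow T. f A B" "\<lambda>A. \<Sum>B\<in>Pow T. g A B"] assms(3) by blast
qed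

section \<open>Permanents of submatrices and Kronecker products as permutation sums\<close>

lemma bij_betw_pick:
  assumes "finite I"
  shows "bij_betw (pick I) {0..<card I} I"
proof -
  have inj: "inj_on (pick I) {0..<card I}"
  proof (rule inj_onI)
    fix i j assume "i \<in> {0..<card I}" "j \<in> {0..<card I}" "pick I i = pick I j"
    then show "i = j"
      using pick_mono_le[of i I j] pick_mono_le[of j I i] by (cases i j rule: linorder_cases) auto
  qed
  have "pick I ` {0..<card I} \<subseteq> I"
    using pick_in_set_le by auto
  then have "pick I ` {0..<card I} = I"
    by (rule card_subset_eq[OF assms]) (simp add: card_image inj)
  with inj show ?thesis
    by (simp add: bij_betw_def)
qed

lemma permanent_submatrix:
  fixes A :: "real mat"
  assumes "A \<in> carrier_mat n n" "I \<subseteq> {0..<n}" "J \<subseteq> {0..<n}" "card I = m" "card J = m"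
  shows "permanent (submatrix A I J) = (\<Sum>\<sigma> | \<sigma> permutes {0..<m}. \<Prod>i\<in>{0..<m}. A $$ (pick I i, pick J (\<sigma> i)))"
proof -
  have "{i. i < dim_row A \<and> i \<in> I} = I" "{j. j < dim_col A \<and> j \<in> J} = J"
    using assms by auto
  then have sub: "submatrix A I J = mat m m (\<lambda>(i, j). A $$ (pick I i, pick J j))"
    using assms by (simp add: submatrix_def)
  show ?thesis
    unfolding permanent_def sub dim_row_mat
  proof (rule sum.cong[OF refl], rule prod.cong[OF refl])
    fix \<sigma> i assume \<sigma>: "\<sigma> \<in> {p. p permutes {0..<m}}" and i: "i \<in> {0..<m}"
    then have "\<sigma> i \<in> {0..<m}"
      using permutes_in_image[of \<sigma> "{0..<m}" i] by blast
    then show "mat m m (\<lambda>(i, j). A $$ (pick I i, pick J j)) $$ (i, \<sigma> i) = A $$ (pick I i, pick J (\<sigma> i))"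
      using i by simp
  qed
qed

lemma permanent_kronecker_all_ones:
  fixes A :: "real mat"
  assumes "A \<in> carrier_mat n n"
  shows "permanent (kronecker A (all_ones_mat 2)) =
    (\<Sum>\<rho> | \<rho> permutes {0..<2 * n}. \<Prod>m\<in>{0..<2 * n}. A $$ (m div 2, \<rho> m div 2))"
proof -
  have K: "kronecker A (all_ones_mat 2) = mat (2 * n) (2 * n) (\<lambda>(i, j). A $$ (i div 2, j div 2))"
    using assms by (auto simp: kronecker_def all_ones_mat_def mult.commute intro!: cong_mat)
  show ?thesis
    unfolding permanent_def K dim_row_mat
  proof (rule sum.cong[OF refl], rule prod.cong[OF refl])
    fix \<rho> m assume \<rho>: "\<rho> \<in> {p. p permutes {0..<2 * n}}" and m: "m \<in> {0..<2 * n}"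
    then have "\<rho> m \<in> {0..<2 * n}"
      using permutes_in_image[of \<rho> "{0..<2 * n}" m] by blast
    then show "mat (2 * n) (2 * n) (\<lambda>(i, j). A $$ (i div 2, j div 2)) $$ (m, \<rho> m) = A $$ (m div 2, \<rho> m div 2)"
      using m by simp
  qed
qed

text \<open>Its double zeta transform in \<open>A\<close> and \<open>B\<close> is the squared
  permanent with every row form replaced by \<open>Q\<close> and every column form by
  \<open>R\<close>. The degree in each variable is \<open>m\<close>, and at sets of size
  \<open>m\<close> it recovers a submatrix permanent.\<close>

definition permanent_coeff :: "real mat \<Rightarrow> real mat \<Rightarrow> nat \<Rightarrow> nat set \<Rightarrow> nat set \<Rightarrow> real" where
  "permanent_coeff U V m A B = (\<Sum>\<psi>\<in>onto_maps m A. \<Sum>\<phi>\<in>onto_maps m B.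
     (\<Sum>\<sigma> | \<sigma> permutes {0..<m}. \<Prod>i\<in>{0..<m}. dot (row_vec U (\<psi> i)) (row_vec V (\<phi> (\<sigma> i))))\<^sup>2)"

definition doubled_coeff :: "real mat \<Rightarrow> real mat \<Rightarrow> nat \<Rightarrow> nat set \<Rightarrow> nat set \<Rightarrow> real" where
  "doubled_coeff U V n A B = (\<Sum>\<psi>\<in>onto_maps n A. \<Sum>\<phi>\<in>onto_maps n B.
     \<Sum>\<rho> | \<rho> permutes {0..<2 * n}. \<Prod>m\<in>{0..<2 * n}. dot (row_vec U (\<psi> (m div 2))) (row_vec V (\<phi> (\<rho> m div 2))))"

lemma permanent_coeff_eq_0: "m < card A \<or> m < card B \<Longrightarrow> permanent_coeff U V m A B = 0"
  by (auto simp: permanent_coeff_def onto_maps_empty)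

lemma mult_transpose_index:
  assumes "U \<in> carrier_mat n 2" "V \<in> carrier_mat n 2" "i < n" "j < n"
  shows "(U * transpose_mat V) $$ (i, j) = dot (row_vec U i) (row_vec V j)"
proof -
  have "{0..<2} = {0, 1 :: nat}" by auto
  then show ?thesis
    using assms by (simp add: scalar_prod_def dot_def row_vec_def)
qed

lemma permanent_coeff_eq:
  assumes UV: "U \<in> carrier_mat n 2" "V \<in> carrier_mat n 2" "A = U * transpose_mat V"
    and I: "I \<subseteq> {0..<n}" "card I = m" and J: "J \<subseteq> {0..<n}" "card J = m"
  shows "permanent_coeff U V m I J = (fact m)\<^sup>2 * (permanent (submatrix A I J))\<^sup>2"
proof -
  have A: "A \<in> carrier_mat n n"
    using UV by auto
  have fin: "finite I" "finite J"
    using I J finite_subset by blast+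
  have "(\<Sum>\<sigma> | \<sigma> permutes {0..<m}. \<Prod>i\<in>{0..<m}. dot (row_vec U (\<psi> i)) (row_vec V (\<phi> (\<sigma> i)))) =
      permanent (submatrix A I J)" if "\<psi> \<in> onto_maps m I" "\<phi> \<in> onto_maps m J" for \<psi> \<phi>
  proof -
    have pick: "bij_betw (pick I) {0..<m} I" "bij_betw (pick J) {0..<m} J"
      using bij_betw_pick[OF fin(1)] bij_betw_pick[OF fin(2)] unfolding I(2) J(2) by simp_all
    have "(\<Sum>\<sigma> | \<sigma> permutes {0..<m}. \<Prod>i\<in>{0..<m}. dot (row_vec U (\<psi> i)) (row_vec V (\<phi> (\<sigma> i)))) =
      (\<Sum>\<sigma> | \<sigma> permutes {0..<m}. \<Prod>i\<in>{0..<m}. dot (row_vec U (pick I i)) (row_vec V (pick J (\<sigma> i))))"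
      by (rule perm_sum_bij_cong[OF _ pick(1) onto_maps_bij_betw[OF that(1) I(2)] pick(2)
            onto_maps_bij_betw[OF that(2) J(2)]]) simp
    also have "\<dots> = permanent (submatrix A I J)"
      unfolding permanent_submatrix[OF A I(1) J(1) I(2) J(2)]
    proof (intro sum.cong refl prod.cong)
      fix \<sigma> i assume \<sigma>: "\<sigma> \<in> {p. p permutes {0..<m}}" and i: "i \<in> {0..<m}"
      then have "\<sigma> i \<in> {0..<m}"
        using permutes_in_image[of \<sigma> "{0..<m}" i] by blast
      then have "pick I i \<in> {0..<n}" "pick J (\<sigma> i) \<in> {0..<n}"
        using bij_betw_apply[OF pick(1) i] bij_betw_apply[OF pick(2)] subsetD[OF I(1)] subsetD[OF J(1)] by simp_all
      then show "dot (row_vec U (pick I i)) (row_vec V (pick J (\<sigma> i))) = A $$ (pick I i, pick J (\<sigma> i))"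
        using mult_transpose_index[OF UV(1,2)] UV(3) by simp
    qed
    finally show ?thesis .
  qed
  then have "permanent_coeff U V m I J = (\<Sum>\<psi>\<in>onto_maps m I. \<Sum>\<phi>\<in>onto_maps m J. (permanent (submatrix A I J))\<^sup>2)"
    unfolding permanent_coeff_def by (intro sum.cong refl) simp
  then show ?thesis
    by (simp add: card_onto_maps fin I J power2_eq_square)
qed

lemma permanent_coeff_full:
  assumes "U \<in> carrier_mat n 2" "V \<in> carrier_mat n 2" "A = U * transpose_mat V"
  shows "permanent_coeff U V n {0..<n} {0..<n} = (fact n)\<^sup>2 * (permanent A)\<^sup>2"
proof -
  have A: "A \<in> carrier_mat n n"
    using assms by auto
  have "submatrix A {0..<n} {0..<n} = A"
  proof -
    have "pick {0..<n} i = i" if "i < n" for i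
      using pick_reduce_set[of i n UNIV] that by (simp add: pick_UNIV atLeast0LessThan lessThan_def)
    moreover have "{i. i < n \<and> i \<in> {0..<n}} = {0..<n}" by auto
    ultimately show ?thesis
      using A by (intro eq_matI) (auto simp: submatrix_def)
  qed
  with permanent_coeff_eq[OF assms, of "{0..<n}" n "{0..<n}"] show ?thesis by simp
qed

text \<open>A doubled index is a pair of an index and a copy; relabelling the indices and keeping
  the copy is again bijective, so \<open>perm_sum_bij_cong\<close> also covers the Kronecker
  product.\<close>

lemma bij_betw_div_mod_2:
  assumes "bij_betw \<psi> {0..<n} A"
  shows "bij_betw (\<lambda>m. (\<psi> (m div 2), m mod 2)) {0..<2 * n} (A \<times> {0..<2::nat})"
proof -
  have "bij_betw (\<lambda>m. (m div 2, m mod 2)) {0..<2 * n} ({0..<n} \<times> {0..<2::nat})"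
    by (rule bij_betw_byWitness[where f' = "\<lambda>(i, b). 2 * i + b"]) auto
  moreover have "bij_betw (map_prod \<psi> id) ({0..<n} \<times> {0..<2::nat}) (A \<times> {0..<2})"
    using assms by (intro bij_betw_map_prod bij_betw_id)
  ultimately have "bij_betw (map_prod \<psi> id \<circ> (\<lambda>m. (m div 2, m mod 2))) {0..<2 * n} (A \<times> {0..<2::nat})"
    by (rule bij_betw_trans)
  then show ?thesis
    by (simp add: o_def)
qed

lemma doubled_coeff_full:
  assumes UV: "U \<in> carrier_mat n 2" "V \<in> carrier_mat n 2" "A = U * transpose_mat V"
  shows "doubled_coeff U V n {0..<n} {0..<n} = (fact n)\<^sup>2 * permanent (kronecker A (all_ones_mat 2))"
proof -
  let ?N = "{0..<n}" and ?M = "{0..<2 * n}"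
  have A: "A \<in> carrier_mat n n"
    using UV by auto
  have "(\<Sum>\<rho> | \<rho> permutes ?M. \<Prod>m\<in>?M. dot (row_vec U (\<psi> (m div 2))) (row_vec V (\<phi> (\<rho> m div 2)))) =
      permanent (kronecker A (all_ones_mat 2))" if "\<psi> \<in> onto_maps n ?N" "\<phi> \<in> onto_maps n ?N" for \<psi> \<phi>
  proof -
    \<comment> \<open>The factor does not see which copy is taken; the second components only keep
      the labellings injective.\<close>
    let ?b = "\<lambda>x y. dot (row_vec U (fst x)) (row_vec V (fst y))"
    have bij: "bij_betw \<psi> ?N ?N" "bij_betw \<phi> ?N ?N"
      using that onto_maps_bij_betw by simp_all
    have "(\<Sum>\<rho> | \<rho> permutes ?M. \<Prod>m\<in>?M. dot (row_vec U (\<psi> (m div 2))) (row_vec V (\<phi> (\<rho> m div 2)))) =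
      (\<Sum>\<rho> | \<rho> permutes ?M. \<Prod>m\<in>?M. dot (row_vec U (m div 2)) (row_vec V (\<rho> m div 2)))"
      using perm_sum_bij_cong[where b = ?b, OF _ bij_betw_div_mod_2[OF bij_betw_id] bij_betw_div_mod_2[OF bij(1)]
          bij_betw_div_mod_2[OF bij_betw_id] bij_betw_div_mod_2[OF bij(2)]] by simp
    also have "\<dots> = permanent (kronecker A (all_ones_mat 2))"
      unfolding permanent_kronecker_all_ones[OF A]
    proof (intro sum.cong refl prod.cong)
      fix \<rho> m assume \<rho>: "\<rho> \<in> {p. p permutes ?M}" and m: "m \<in> ?M"
      then have "\<rho> m \<in> ?M"
        using permutes_in_image[of \<rho> ?M m] by blast
      then show "dot (row_vec U (m div 2)) (row_vec V (\<rho> m div 2)) = A $$ (m div 2, \<rho> m div 2)"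
        using mult_transpose_index[OF UV(1,2), of "m div 2" "\<rho> m div 2"] UV(3) m by auto
    qed
    finally show ?thesis .
  qed
  then have "doubled_coeff U V n ?N ?N = (\<Sum>\<psi>\<in>onto_maps n ?N. \<Sum>\<phi>\<in>onto_maps n ?N. permanent (kronecker A (all_ones_mat 2)))"
    unfolding doubled_coeff_def by (intro sum.cong refl) simp
  then show ?thesis
    by (simp add: card_onto_maps power2_eq_square)
qed

section \<open>Products of determinant powers with permanents, and the comparison of zeta
  transforms\<close>

definition mixed_coeff :: "real mat \<Rightarrow> real mat \<Rightarrow> nat \<Rightarrow> nat \<Rightarrow> nat set \<Rightarrow> nat set \<Rightarrow> real" where
  "mixed_coeff U V n k A B = union_conv (matching_coeff U k)
     (\<lambda>A'. union_conv (matching_coeff V k) (permanent_coeff U V (n - 2 * k) A') B) A"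

lemma mixed_coeff_zeta:
  assumes "finite S" "finite T" "dim_col U = 2" "dim_col V = 2"
  shows "(\<Sum>A\<in>Pow S. \<Sum>B\<in>Pow T. mixed_coeff U V n k A B) =
    (gram_det (row_vec U) S * gram_det (row_vec V) T) ^ k *
    (\<Sum>A\<in>Pow S. \<Sum>B\<in>Pow T. permanent_coeff U V (n - 2 * k) A B)"
proof -
  let ?p = "permanent_coeff U V (n - 2 * k)" and ?u = "matching_coeff U k" and ?v = "matching_coeff V k"
  have "(gram_det (row_vec U) S * gram_det (row_vec V) T) ^ k * (\<Sum>A\<in>Pow S. \<Sum>B\<in>Pow T. ?p A B) =
    (\<Sum>A\<in>Pow S. ?u A) * (\<Sum>A\<in>Pow S. (\<Sum>B\<in>Pow T. ?v B) * (\<Sum>B\<in>Pow T. ?p A B))"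
    by (simp only: power_mult_distrib gram_det_power_zeta assms sum_distrib_left[symmetric] mult.assoc)
  also have "\<dots> = (\<Sum>A\<in>Pow S. union_conv ?u (\<lambda>A'. \<Sum>B\<in>Pow T. union_conv ?v (?p A') B) A)"
    by (simp add: zeta_mult assms)
  also have "\<dots> = (\<Sum>A\<in>Pow S. \<Sum>B\<in>Pow T. mixed_coeff U V n k A B)"
  proof (intro sum.cong refl)
    fix A
    show "union_conv ?u (\<lambda>A'. \<Sum>B\<in>Pow T. union_conv ?v (?p A') B) A = (\<Sum>B\<in>Pow T. mixed_coeff U V n k A B)"
      unfolding mixed_coeff_def union_conv_def[of ?u] case_prod_unfold sum_distrib_left
      by (rule sum.swap)
  qed
  finally show ?thesis ..
qed

lemma sum_over_complements:
  assumes "finite N" "k \<le> card N"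
  shows "(\<Sum>A | A \<subseteq> N \<and> card A = k. F A) = (\<Sum>I | I \<subseteq> N \<and> card I = card N - k. F (N - I))"
proof (rule sum.reindex_bij_witness[where i = "\<lambda>I. N - I" and j = "\<lambda>A. N - A"])
  fix A assume "A \<in> {A. A \<subseteq> N \<and> card A = k}"
  then have "A \<subseteq> N" "card A = k" "finite A"
    using assms(1) finite_subset by auto
  then show "N - (N - A) = A" "F (N - (N - A)) = F A" "N - A \<in> {I. I \<subseteq> N \<and> card I = card N - k}"
    using assms by (auto simp: double_diff card_Diff_subset)
next
  fix I assume "I \<in> {I. I \<subseteq> N \<and> card I = card N - k}"
  then have "I \<subseteq> N" "card I = card N - k" "finite I"
    using assms(1) finite_subset by auto
  then show "N - (N - I) = I" "N - I \<in> {A. A \<subseteq> N \<and> card A = k}"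
    using assms by (auto simp: double_diff card_Diff_subset)
qed

text \<open>The degrees \<open>2 * k\<close> and \<open>n - 2 * k\<close> add up to
  \<open>n\<close>, so in either variable only complementary pairs contribute at the full set. Each
  of the two matching coefficients brings a \<open>fact k\<close>, and the permanent coefficient
  brings \<open>(fact (n - 2 * k))\<^sup>2\<close>.\<close>

lemma mixed_coeff_full:
  assumes UV: "U \<in> carrier_mat n 2" "V \<in> carrier_mat n 2" "A = U * transpose_mat V" and k: "2 * k \<le> n"
  shows "mixed_coeff U V n k {0..<n} {0..<n} = (fact k)\<^sup>2 * (fact (n - 2 * k))\<^sup>2 *
    (\<Sum>(I, J) | I \<subseteq> {0..<n} \<and> J \<subseteq> {0..<n} \<and> card I = n - 2 * k \<and> card J = n - 2 * k.
       (permanent (submatrix A I J))\<^sup>2 * Delta U ({0..<n} - I) * Delta V ({0..<n} - J))"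
proof -
  let ?N = "{0..<n}" and ?p = "permanent_coeff U V (n - 2 * k)"
  let ?X = "{I. I \<subseteq> ?N \<and> card I = n - 2 * k}"
  have zero: "matching_coeff W k B = 0" if "B \<subseteq> ?N" "2 * k < card B" for W B
    using matching_coeff_eq_0 that finite_subset by blast
  have compl: "(\<Sum>B | B \<subseteq> ?N \<and> card B = 2 * k. F B) = (\<Sum>I\<in>?X. F (?N - I))" for F :: "nat set \<Rightarrow> real"
    using sum_over_complements[of ?N "2 * k" F] k by simp
  have inner: "union_conv (matching_coeff V k) (?p A') ?N = (\<Sum>J\<in>?X. matching_coeff V k (?N - J) * ?p A' J)" for A'
  proof -
    have "union_conv (matching_coeff V k) (?p A') ?N =
      (\<Sum>B | B \<subseteq> ?N \<and> card B = 2 * k. matching_coeff V k B * ?p A' (?N - B))"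
      by (rule union_conv_degree(2)[where q = "n - 2 * k"]) (use zero permanent_coeff_eq_0 k in auto)
    then show ?thesis
      unfolding compl by (simp add: double_diff)
  qed
  have "mixed_coeff U V n k ?N ?N = (\<Sum>B | B \<subseteq> ?N \<and> card B = 2 * k. matching_coeff U k B *
      (\<Sum>J\<in>?X. matching_coeff V k (?N - J) * ?p (?N - B) J))"
    unfolding mixed_coeff_def inner
    by (rule union_conv_degree(2)[where q = "n - 2 * k"]) (use zero permanent_coeff_eq_0 k in auto)
  also have "\<dots> = (\<Sum>I\<in>?X. matching_coeff U k (?N - I) * (\<Sum>J\<in>?X. matching_coeff V k (?N - J) * ?p I J))"
    unfolding compl by (intro sum.cong refl) (simp add: double_diff)
  also have "\<dots> = (\<Sum>I\<in>?X. \<Sum>J\<in>?X. (fact k)\<^sup>2 * (fact (n - 2 * k))\<^sup>2 *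
      ((permanent (submatrix A I J))\<^sup>2 * Delta U (?N - I) * Delta V (?N - J)))"
    unfolding sum_distrib_left
  proof (intro sum.cong refl)
    fix I J assume I: "I \<in> ?X" and J: "J \<in> ?X"
    have "matching_coeff W k (?N - B) = fact k * Delta W (?N - B)" if "B \<in> ?X" for W B
      using that k finite_subset[of B ?N] by (intro matching_coeff_eq_Delta) (auto simp: card_Diff_subset)
    then show "matching_coeff U k (?N - I) * (matching_coeff V k (?N - J) * ?p I J) =
      (fact k)\<^sup>2 * (fact (n - 2 * k))\<^sup>2 *
      ((permanent (submatrix A I J))\<^sup>2 * Delta U (?N - I) * Delta V (?N - J))"
      using I J permanent_coeff_eq[OF UV, of I "n - 2 * k" J] by (simp add: power2_eq_square)
  qed
  also have "\<dots> = (\<Sum>(I, J)\<in>?X \<times> ?X. (fact k)\<^sup>2 * (fact (n - 2 * k))\<^sup>2 *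
      ((permanent (submatrix A I J))\<^sup>2 * Delta U (?N - I) * Delta V (?N - J)))"
    by (rule sum.cartesian_product)
  also have "\<dots> = (fact k)\<^sup>2 * (fact (n - 2 * k))\<^sup>2 * (\<Sum>(I, J)\<in>?X \<times> ?X.
      (permanent (submatrix A I J))\<^sup>2 * Delta U (?N - I) * Delta V (?N - J))"
    by (simp add: sum_distrib_left case_prod_unfold)
  also have "?X \<times> ?X = {(I, J). I \<subseteq> ?N \<and> J \<subseteq> ?N \<and> card I = n - 2 * k \<and> card J = n - 2 * k}"
    by auto
  finally show ?thesis .
qed

text \<open>For fixed \<open>S\<close> and \<open>T\<close> the forms can be diagonalized, and the
  claim is an identity in the two eigenvalues. The denominators anticipate the passage back to
  permanents: polarization contributes an extra \<open>(fact n)\<^sup>2\<close> on the left, and on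
  the right the factorials of \<open>mixed_coeff_full\<close>.\<close>

lemma permanent_difference_zeta:
  assumes "finite S" "finite T" "dim_col U = 2" "dim_col V = 2"
  shows "(\<Sum>A\<in>Pow S. \<Sum>B\<in>Pow T. permanent_coeff U V n A B / (fact n)^4 -
      doubled_coeff U V n A B / (fact (2 * n) * (fact n)\<^sup>2)) =
    (\<Sum>A\<in>Pow S. \<Sum>B\<in>Pow T. \<Sum>k = 1..n div 2.
      coeff_C n k / ((fact (n - 2 * k))^4 * (fact k)\<^sup>2) * mixed_coeff U V n k A B)"
proof -
  obtain w :: "bool \<Rightarrow> real \<times> real" and l
    where R: "\<And>x y. (\<Sum>t\<in>T. dot x (row_vec V t) * dot y (row_vec V t)) = (\<Sum>c\<in>UNIV. dot x (w c) * dot y (w c))"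
    and Q: "\<And>c d. (\<Sum>s\<in>S. dot (w c) (row_vec U s) * dot (w d) (row_vec U s)) = (if c = d then l c else 0)"
    and l: "\<And>c. l c \<ge> 0"
    and det: "gram_det (row_vec U) S * gram_det (row_vec V) T = l True * l False"
    by (rule simultaneous_diagonalization[where T = T and v = "row_vec V" and S = S and u = "row_vec U"], rule that)
  define h where "h m = (\<Sum>k\<le>m. l True ^ k * l False ^ (m - k))" for m
  have perm: "(\<Sum>A\<in>Pow S. \<Sum>B\<in>Pow T. permanent_coeff U V m A B) = (fact m)\<^sup>2 * h m" for m
    using double_permanent_sum_eval[OF R Q l, of "{0..<m}"] assms
    unfolding permanent_coeff_def h_def by (simp add: double_zeta)
  have doubled: "(\<Sum>A\<in>Pow S. \<Sum>B\<in>Pow T. doubled_coeff U V n A B) =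
      fact (2 * n) * (\<Sum>k\<le>n. legendre_coeff n k * (l True ^ k * l False ^ (n - k)))"
  proof -
    have "(\<Sum>A\<in>Pow S. \<Sum>B\<in>Pow T. doubled_coeff U V n A B) =
      (\<Sum>k\<le>n. (real (n choose k))\<^sup>2 * (fact (2 * k) * fact (2 * n - 2 * k)) * (l True ^ k * l False ^ (n - k)))"
      using doubled_permanent_sum_eval[OF R Q l, of n] assms
      unfolding doubled_coeff_def by (simp add: double_zeta)
    also have "\<dots> = (\<Sum>k\<le>n. fact (2 * n) * (legendre_coeff n k * (l True ^ k * l False ^ (n - k))))"
      by (intro sum.cong refl) (simp add: legendre_coeff_def binomial_fact[of "2 * _" "2 * n"])
    finally show ?thesis
      by (simp add: sum_distrib_left)
  qed
  have "(\<Sum>A\<in>Pow S. \<Sum>B\<in>Pow T. permanent_coeff U V n A B / (fact n)^4 -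
      doubled_coeff U V n A B / (fact (2 * n) * (fact n)\<^sup>2)) =
    (\<Sum>A\<in>Pow S. \<Sum>B\<in>Pow T. permanent_coeff U V n A B) / (fact n)^4 -
    (\<Sum>A\<in>Pow S. \<Sum>B\<in>Pow T. doubled_coeff U V n A B) / (fact (2 * n) * (fact n)\<^sup>2)"
    by (simp add: sum_subtractf sum_divide_distrib)
  also have "\<dots> = (h n - (\<Sum>k\<le>n. legendre_coeff n k * (l True ^ k * l False ^ (n - k)))) / (fact n)\<^sup>2"
  proof -
    have "(fact n)\<^sup>2 * x / (fact n)^4 - fact (2 * n) * y / (fact (2 * n) * (fact n)\<^sup>2) = (x - y) / (fact n)\<^sup>2"
      for x y :: real
      by (simp add: field_simps eval_nat_numeral)
    then show ?thesis
      unfolding perm doubled by simp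
  qed
  also have "\<dots> = (\<Sum>k = 1..n div 2. (legendre_coeff n (k - 1) - legendre_coeff n k) / (fact n)\<^sup>2 *
      ((l True * l False) ^ k * h (n - 2 * k)))"
    unfolding h_def sum_geometric_minus_legendre sum_divide_distrib by simp
  also have "\<dots> = (\<Sum>k = 1..n div 2. coeff_C n k / ((fact (n - 2 * k))^4 * (fact k)\<^sup>2) *
      ((l True * l False) ^ k * ((fact (n - 2 * k))\<^sup>2 * h (n - 2 * k))))"
  proof (intro sum.cong refl)
    fix k assume "k \<in> {1..n div 2}"
    then have "1 \<le> k" "2 * k \<le> n" by auto
    note diff = legendre_coeff_diff[OF this]
    show "(legendre_coeff n (k - 1) - legendre_coeff n k) / (fact n)\<^sup>2 * ((l True * l False) ^ k * h (n - 2 * k)) =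
      coeff_C n k / ((fact (n - 2 * k))^4 * (fact k)\<^sup>2) *
      ((l True * l False) ^ k * ((fact (n - 2 * k))\<^sup>2 * h (n - 2 * k)))"
      unfolding diff by (simp add: field_simps eval_nat_numeral)
  qed
  also have "\<dots> = (\<Sum>k = 1..n div 2. coeff_C n k / ((fact (n - 2 * k))^4 * (fact k)\<^sup>2) *
      (\<Sum>A\<in>Pow S. \<Sum>B\<in>Pow T. mixed_coeff U V n k A B))"
    by (simp add: mixed_coeff_zeta assms det perm)
  also have "\<dots> = (\<Sum>k = 1..n div 2. \<Sum>A\<in>Pow S. \<Sum>B\<in>Pow T.
      coeff_C n k / ((fact (n - 2 * k))^4 * (fact k)\<^sup>2) * mixed_coeff U V n k A B)"
    by (simp only: sum_distrib_left)
  also have "\<dots> = (\<Sum>A\<in>Pow S. \<Sum>B\<in>Pow T. \<Sum>k = 1..n div 2.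
      coeff_C n k / ((fact (n - 2 * k))^4 * (fact k)\<^sup>2) * mixed_coeff U V n k A B)"
    by (subst sum.swap, intro sum.cong refl, rule sum.swap)
  finally show ?thesis .
qed

text \<open>Since the zeta transforms agree at all pairs of index sets, the set functions agree at
  the full pair, where both sides turn back into permanents and matching sums.\<close>

lemma permanent_difference_eq:
  assumes UV: "U \<in> carrier_mat n 2" "V \<in> carrier_mat n 2" "A = U * transpose_mat V"
  shows "(permanent A)\<^sup>2 / (fact n)\<^sup>2 - permanent (kronecker A (all_ones_mat 2)) / fact (2 * n) =
    (\<Sum>k = 1..n div 2. coeff_C n k *
      (\<Sum>(I, J) | I \<subseteq> {0..<n} \<and> J \<subseteq> {0..<n} \<and> card I = n - 2 * k \<and> card J = n - 2 * k.
         (permanent (submatrix A I J))\<^sup>2 / (fact (n - 2 * k))\<^sup>2 *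
         Delta U ({0..<n} - I) * Delta V ({0..<n} - J)))"
proof -
  let ?N = "{0..<n}"
  have "permanent_coeff U V n ?N ?N / (fact n)^4 - doubled_coeff U V n ?N ?N / (fact (2 * n) * (fact n)\<^sup>2) =
    (\<Sum>k = 1..n div 2. coeff_C n k / ((fact (n - 2 * k))^4 * (fact k)\<^sup>2) * mixed_coeff U V n k ?N ?N)"
  proof (rule double_zeta_unique[where I = ?N and J = ?N and
        f = "\<lambda>A B. permanent_coeff U V n A B / (fact n)^4 - doubled_coeff U V n A B / (fact (2 * n) * (fact n)\<^sup>2)" and
        g = "\<lambda>A B. \<Sum>k = 1..n div 2. coeff_C n k / ((fact (n - 2 * k))^4 * (fact k)\<^sup>2) * mixed_coeff U V n k A B"])
    fix S T assume "S \<subseteq> ?N" "T \<subseteq> ?N"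
    then have "finite S" "finite T"
      using finite_subset by blast+
    then show "(\<Sum>A\<in>Pow S. \<Sum>B\<in>Pow T. permanent_coeff U V n A B / (fact n)^4 -
        doubled_coeff U V n A B / (fact (2 * n) * (fact n)\<^sup>2)) =
      (\<Sum>A\<in>Pow S. \<Sum>B\<in>Pow T. \<Sum>k = 1..n div 2.
        coeff_C n k / ((fact (n - 2 * k))^4 * (fact k)\<^sup>2) * mixed_coeff U V n k A B)"
      using permanent_difference_zeta UV by auto
  qed simp_all
  also have "\<dots> = (\<Sum>k = 1..n div 2. coeff_C n k *
      (\<Sum>(I, J) | I \<subseteq> ?N \<and> J \<subseteq> ?N \<and> card I = n - 2 * k \<and> card J = n - 2 * k.
         (permanent (submatrix A I J))\<^sup>2 / (fact (n - 2 * k))\<^sup>2 * Delta U (?N - I) * Delta V (?N - J)))"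
  proof (intro sum.cong refl)
    fix k assume "k \<in> {1..n div 2}"
    then have "2 * k \<le> n" by auto
    note full = mixed_coeff_full[OF UV this]
    let ?X = "{(I, J). I \<subseteq> ?N \<and> J \<subseteq> ?N \<and> card I = n - 2 * k \<and> card J = n - 2 * k}"
    have scale: "coeff_C n k / ((fact (n - 2 * k))^4 * (fact k)\<^sup>2) * ((fact k)\<^sup>2 * (fact (n - 2 * k))\<^sup>2 * x) =
      coeff_C n k * (x / (fact (n - 2 * k))\<^sup>2)" for x
      by (simp add: field_simps eval_nat_numeral)
    have "(\<Sum>(I, J)\<in>?X. (permanent (submatrix A I J))\<^sup>2 * Delta U (?N - I) * Delta V (?N - J)) / (fact (n - 2 * k))\<^sup>2 =
      (\<Sum>(I, J)\<in>?X. (permanent (submatrix A I J))\<^sup>2 / (fact (n - 2 * k))\<^sup>2 * Delta U (?N - I) * Delta V (?N - J))"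
      by (simp add: sum_divide_distrib case_prod_unfold)
    then show "coeff_C n k / ((fact (n - 2 * k))^4 * (fact k)\<^sup>2) * mixed_coeff U V n k ?N ?N =
      coeff_C n k * (\<Sum>(I, J)\<in>?X.
         (permanent (submatrix A I J))\<^sup>2 / (fact (n - 2 * k))\<^sup>2 * Delta U (?N - I) * Delta V (?N - J))"
      unfolding full scale by (rule arg_cong)
  qed
  moreover have "(fact n)\<^sup>2 * x / (fact n)^4 - (fact n)\<^sup>2 * y / (fact (2 * n) * (fact n)\<^sup>2) =
      x / (fact n)\<^sup>2 - y / fact (2 * n)" for x y :: real
    by (simp add: field_simps eval_nat_numeral)
  ultimately show ?thesis
    unfolding permanent_coeff_full[OF UV] doubled_coeff_full[OF UV] by simp
qed

section \<open>Sums of squares\<close>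

definition monomial_value :: "('v \<Rightarrow> real) \<Rightarrow> ('v \<Rightarrow>\<^sub>0 nat) \<Rightarrow> real" where
  "monomial_value x m = (\<Prod>v\<in>Poly_Mapping.keys m. x v ^ Poly_Mapping.lookup m v)"

definition monomial_degree :: "('v \<Rightarrow>\<^sub>0 nat) \<Rightarrow> nat" where
  "monomial_degree m = (\<Sum>v\<in>Poly_Mapping.keys m. Poly_Mapping.lookup m v)"

text \<open>Lets monomials with different supports be compared over one common finite set of
  variables.\<close>

lemma monomial_value_superset:
  "finite A \<Longrightarrow> Poly_Mapping.keys m \<subseteq> A \<Longrightarrow> monomial_value x m = (\<Prod>v\<in>A. x v ^ Poly_Mapping.lookup m v)"
  unfolding monomial_value_def by (rule prod.mono_neutral_left) (auto simp: in_keys_iff)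

lemma monomial_degree_superset:
  "finite A \<Longrightarrow> Poly_Mapping.keys m \<subseteq> A \<Longrightarrow> monomial_degree m = (\<Sum>v\<in>A. Poly_Mapping.lookup m v)"
  unfolding monomial_degree_def by (rule sum.mono_neutral_left) (auto simp: in_keys_iff)

lemma monomial_value_add: "monomial_value x (m + m') = monomial_value x m * monomial_value x m'"
  using monomial_value_superset[of "Poly_Mapping.keys m \<union> Poly_Mapping.keys m'"] keys_add[of m m']
  by (simp add: lookup_add power_add prod.distrib)

lemma monomial_degree_add: "monomial_degree (m + m') = monomial_degree m + monomial_degree m'"
  using monomial_degree_superset[of "Poly_Mapping.keys m \<union> Poly_Mapping.keys m'"] keys_add[of m m']
  by (simp add: lookup_add sum.distrib)

lemma mpoly_eval_superset:
  assumes "finite A" "Poly_Mapping.keys p \<subseteq> A"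
  shows "mpoly_eval x p = (\<Sum>m\<in>A. Poly_Mapping.lookup p m * monomial_value x m)"
  unfolding mpoly_eval_def monomial_value_def[symmetric]
  by (rule sum.mono_neutral_left) (use assms in \<open>auto simp: in_keys_iff\<close>)

lemma mpoly_eval_add: "mpoly_eval x (p + q) = mpoly_eval x p + mpoly_eval x q"
  using mpoly_eval_superset[of "Poly_Mapping.keys p \<union> Poly_Mapping.keys q"] keys_add[of p q]
  by (simp add: lookup_add distrib_right sum.distrib)

lemma mpoly_eval_0: "mpoly_eval x 0 = 0"
  by (simp add: mpoly_eval_def)

lemma mpoly_eval_single: "mpoly_eval x (Poly_Mapping.single m c) = c * monomial_value x m"
  using mpoly_eval_superset[of "{m}" "Poly_Mapping.single m c"] by (simp add: lookup_single)

text \<open>Updating at a fresh key is the same as adding a single term, so polynomials can be built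
  up additively.\<close>

lemma poly_mapping_induct_single:
  assumes "P 0" and "\<And>p m c. P p \<Longrightarrow> P (p + Poly_Mapping.single m c)"
  shows "P (p :: 'a \<Rightarrow>\<^sub>0 real)"
proof (induction p rule: Poly_Mapping.update_induct)
  case const
  then show ?case using assms(1) .
next
  case (update f a b)
  have "Poly_Mapping.update a b f = f + Poly_Mapping.single a b"
    by (rule poly_mapping_eqI) (use update in \<open>auto simp: lookup_update lookup_add lookup_single in_keys_iff\<close>)
  with assms(2)[OF update(3)] show ?case by simp
qed

text \<open>Both sides are additive in each factor, so one induction per factor reduces the claim to
  two single terms.\<close>

lemma mpoly_eval_mult: "mpoly_eval x (p * q) = mpoly_eval x p * mpoly_eval x q"
proof (induction q rule: poly_mapping_induct_single)
  case 1
  show ?case by (simp add: mpoly_eval_0)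
next
  case (2 q m c)
  have "mpoly_eval x (p * Poly_Mapping.single m c) = mpoly_eval x p * mpoly_eval x (Poly_Mapping.single m c)"
  proof (induction p rule: poly_mapping_induct_single)
    case 1
    show ?case by (simp add: mpoly_eval_0)
  next
    case (2 p m' c')
    then show ?case
      by (simp add: distrib_right mpoly_eval_add mult_single mpoly_eval_single monomial_value_add)
  qed
  with 2 show ?case
    by (simp add: distrib_left mpoly_eval_add)
qed

lemma homogeneous_iff: "homogeneous d p \<longleftrightarrow> (\<forall>m\<in>Poly_Mapping.keys p. monomial_degree m = d)"
  by (simp add: homogeneous_def monomial_degree_def)

lemma homogeneous_add: "homogeneous d p \<Longrightarrow> homogeneous d q \<Longrightarrow> homogeneous d (p + q)"
  using keys_add[of p q] by (auto simp: homogeneous_iff)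

lemma homogeneous_mult: "homogeneous d p \<Longrightarrow> homogeneous e q \<Longrightarrow> homogeneous (d + e) (p * q)"
  using keys_mult[of p q] by (force simp: homogeneous_iff monomial_degree_add)

lemma mpoly_vars_add: "mpoly_vars (p + q) \<subseteq> mpoly_vars p \<union> mpoly_vars q"
  using keys_add[of p q] by (auto simp: mpoly_vars_def)

lemma mpoly_vars_mult: "mpoly_vars (p * q) \<subseteq> mpoly_vars p \<union> mpoly_vars q"
proof
  fix v assume "v \<in> mpoly_vars (p * q)"
  then obtain a b where "a \<in> Poly_Mapping.keys p" "b \<in> Poly_Mapping.keys q" "v \<in> Poly_Mapping.keys (a + b)"
    using keys_mult[of p q] by (auto simp: mpoly_vars_def)
  then show "v \<in> mpoly_vars p \<union> mpoly_vars q"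
    using keys_add[of a b] by (auto simp: mpoly_vars_def)
qed

section \<open>Functions represented by homogeneous polynomials and by sums of squares\<close>

text \<open>Hiding the polynomial behind an existential lets the closure rules apply directly to
  formulas in the matrix entries, without writing any polynomial down.\<close>

definition homogeneous_fun :: "'v set \<Rightarrow> nat \<Rightarrow> (('v \<Rightarrow> real) \<Rightarrow> real) \<Rightarrow> bool" where
  "homogeneous_fun X d f \<longleftrightarrow> (\<exists>p. mpoly_vars p \<subseteq> X \<and> homogeneous d p \<and> (\<forall>x. mpoly_eval x p = f x))"

lemma homogeneous_fun_const: "homogeneous_fun X 0 (\<lambda>_. c)"
  unfolding homogeneous_fun_def
  by (rule exI[of _ "Poly_Mapping.single 0 c"])
    (auto simp: mpoly_eval_single monomial_value_def mpoly_vars_def homogeneous_def split: if_splits)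

lemma homogeneous_fun_var: "v \<in> X \<Longrightarrow> homogeneous_fun X 1 (\<lambda>x. x v)"
  unfolding homogeneous_fun_def
  by (rule exI[of _ "Poly_Mapping.single (Poly_Mapping.single v 1) 1"])
    (auto simp: mpoly_eval_single monomial_value_def mpoly_vars_def homogeneous_def)

lemma homogeneous_fun_0: "homogeneous_fun X d (\<lambda>_. 0)"
  unfolding homogeneous_fun_def
  by (rule exI[of _ 0]) (auto simp: mpoly_eval_0 mpoly_vars_def homogeneous_def)

lemma homogeneous_fun_add:
  assumes "homogeneous_fun X d f" "homogeneous_fun X d g"
  shows "homogeneous_fun X d (\<lambda>x. f x + g x)"
proof -
  obtain p q where "mpoly_vars p \<subseteq> X" "homogeneous d p" "\<forall>x. mpoly_eval x p = f x"
    "mpoly_vars q \<subseteq> X" "homogeneous d q" "\<forall>x. mpoly_eval x q = g x"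
    using assms unfolding homogeneous_fun_def by blast
  then show ?thesis
    unfolding homogeneous_fun_def using mpoly_vars_add[of p q]
    by (intro exI[of _ "p + q"]) (auto simp: homogeneous_add mpoly_eval_add)
qed

lemma homogeneous_fun_mult:
  assumes "homogeneous_fun X d f" "homogeneous_fun X e g"
  shows "homogeneous_fun X (d + e) (\<lambda>x. f x * g x)"
proof -
  obtain p q where "mpoly_vars p \<subseteq> X" "homogeneous d p" "\<forall>x. mpoly_eval x p = f x"
    "mpoly_vars q \<subseteq> X" "homogeneous e q" "\<forall>x. mpoly_eval x q = g x"
    using assms unfolding homogeneous_fun_def by blast
  then show ?thesis
    unfolding homogeneous_fun_def using mpoly_vars_mult[of p q]
    by (intro exI[of _ "p * q"]) (auto simp: homogeneous_mult mpoly_eval_mult)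
qed

lemma homogeneous_fun_mult_vars:
  "v \<in> X \<Longrightarrow> w \<in> X \<Longrightarrow> homogeneous_fun X 2 (\<lambda>x. x v * x w)"
  using homogeneous_fun_mult[OF homogeneous_fun_var homogeneous_fun_var, of v X w]
  by (simp add: numeral_2_eq_2)

lemma homogeneous_fun_cmult: "homogeneous_fun X d f \<Longrightarrow> homogeneous_fun X d (\<lambda>x. c * f x)"
  using homogeneous_fun_mult[OF homogeneous_fun_const] by fastforce

lemma homogeneous_fun_diff:
  "homogeneous_fun X d f \<Longrightarrow> homogeneous_fun X d g \<Longrightarrow> homogeneous_fun X d (\<lambda>x. f x - g x)"
  using homogeneous_fun_add[OF _ homogeneous_fun_cmult[of X d g "-1"]] by fastforce

lemma homogeneous_fun_sum:
  "(\<And>a. a \<in> A \<Longrightarrow> homogeneous_fun X d (f a)) \<Longrightarrow> homogeneous_fun X d (\<lambda>x. \<Sum>a\<in>A. f a x)"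
  by (induction A rule: infinite_finite_induct) (auto intro: homogeneous_fun_0 homogeneous_fun_add)

lemma homogeneous_fun_prod:
  "finite A \<Longrightarrow> (\<And>a. a \<in> A \<Longrightarrow> homogeneous_fun X d (f a)) \<Longrightarrow>
    homogeneous_fun X (card A * d) (\<lambda>x. \<Prod>a\<in>A. f a x)"
  by (induction A rule: finite_induct) (auto intro: homogeneous_fun_const homogeneous_fun_mult)

definition sos_fun :: "'v set \<Rightarrow> nat \<Rightarrow> (('v \<Rightarrow> real) \<Rightarrow> real) \<Rightarrow> bool" where
  "sos_fun X d f \<longleftrightarrow>
    (\<exists>p. mpoly_vars p \<subseteq> X \<and> sum_of_squares X p \<and> homogeneous d p \<and> (\<forall>x. mpoly_eval x p = f x))"

lemma sos_fun_0: "sos_fun X d (\<lambda>_. 0)"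
proof -
  have "sum_of_squares X 0"
    unfolding sum_of_squares_def by (rule exI[of _ "[]"]) simp
  then show ?thesis
    unfolding sos_fun_def
    by (intro exI[of _ 0]) (auto simp: mpoly_eval_0 mpoly_vars_def homogeneous_def)
qed

lemma sos_fun_square:
  assumes "homogeneous_fun X d f"
  shows "sos_fun X (2 * d) (\<lambda>x. (f x)\<^sup>2)"
proof -
  obtain q where q: "mpoly_vars q \<subseteq> X" "homogeneous d q" "\<forall>x. mpoly_eval x q = f x"
    using assms unfolding homogeneous_fun_def by blast
  have "sum_of_squares X (q * q)"
    unfolding sum_of_squares_def by (rule exI[of _ "[q]"]) (simp add: q power2_eq_square)
  with q show ?thesis
    unfolding sos_fun_def using mpoly_vars_mult[of q q] homogeneous_mult[OF q(2) q(2)]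
    by (intro exI[of _ "q * q"]) (auto simp: mpoly_eval_mult power2_eq_square mult_2)
qed

lemma sos_fun_add:
  assumes "sos_fun X d f" "sos_fun X d g"
  shows "sos_fun X d (\<lambda>x. f x + g x)"
proof -
  obtain p where p: "mpoly_vars p \<subseteq> X" "sum_of_squares X p" "homogeneous d p" "\<forall>x. mpoly_eval x p = f x"
    using assms(1) unfolding sos_fun_def by blast
  obtain q where q: "mpoly_vars q \<subseteq> X" "sum_of_squares X q" "homogeneous d q" "\<forall>x. mpoly_eval x q = g x"
    using assms(2) unfolding sos_fun_def by blast
  obtain ps qs where "\<forall>q\<in>set ps. mpoly_vars q \<subseteq> X" "p = (\<Sum>q\<leftarrow>ps. q\<^sup>2)"
    "\<forall>q\<in>set qs. mpoly_vars q \<subseteq> X" "q = (\<Sum>q\<leftarrow>qs. q\<^sup>2)"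
    using p(2) q(2) unfolding sum_of_squares_def by blast
  then have "sum_of_squares X (p + q)"
    unfolding sum_of_squares_def by (intro exI[of _ "ps @ qs"]) auto
  with p q show ?thesis
    unfolding sos_fun_def using mpoly_vars_add[of p q]
    by (intro exI[of _ "p + q"]) (auto simp: homogeneous_add mpoly_eval_add)
qed

lemma sos_fun_sum:
  "(\<And>a. a \<in> A \<Longrightarrow> sos_fun X d (f a)) \<Longrightarrow> sos_fun X d (\<lambda>x. \<Sum>a\<in>A. f a x)"
  by (induction A rule: infinite_finite_induct) (auto intro: sos_fun_0 sos_fun_add)

text \<open>The only factor that is not a factorial is \<open>2 * real k - 1\<close>, positive for
  \<open>1 \<le> k\<close>.\<close>

lemma coeff_C_nonneg: "1 \<le> k \<Longrightarrow> coeff_C n k \<ge> 0"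
  unfolding coeff_C_def by (intro divide_nonneg_nonneg mult_nonneg_nonneg) auto

section \<open>The terms of the identity as squares of polynomials in the entries\<close>

text \<open>A generic matrix: quantities built from it become functions of the assignment
  \<open>x\<close> of values to the entry variables.\<close>

definition U_mat :: "nat \<Rightarrow> (entry \<Rightarrow> real) \<Rightarrow> real mat" where
  "U_mat n x = mat n 2 (\<lambda>(i, j). x (U_entry i j))"

definition V_mat :: "nat \<Rightarrow> (entry \<Rightarrow> real) \<Rightarrow> real mat" where
  "V_mat n x = mat n 2 (\<lambda>(i, j). x (V_entry i j))"

lemma homogeneous_fun_permanent:
  assumes "I \<subseteq> {0..<n}" "J \<subseteq> {0..<n}" "card I = m" "card J = m"
  shows "homogeneous_fun (entries n) (2 * m)
    (\<lambda>x. permanent (submatrix (U_mat n x * transpose_mat (V_mat n x)) I J))"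
proof -
  let ?a = "\<lambda>x i j. x (U_entry i 0) * x (V_entry j 0) + x (U_entry i 1) * x (V_entry j 1)"
  have entry: "homogeneous_fun (entries n) 2 (\<lambda>x. ?a x i j)" if "i < n" "j < n" for i j
    by (intro homogeneous_fun_add homogeneous_fun_mult_vars) (use that in \<open>auto simp: entries_def\<close>)
  have pick: "pick I i < n" "pick J i < n" if "i < m" for i
    using pick_in_set_le[of i I] pick_in_set_le[of i J] that assms by auto
  have "permanent (submatrix (U_mat n x * transpose_mat (V_mat n x)) I J) =
    (\<Sum>\<sigma> | \<sigma> permutes {0..<m}. \<Prod>i\<in>{0..<m}. ?a x (pick I i) (pick J (\<sigma> i)))" for x
  proof -
    have UV: "U_mat n x \<in> carrier_mat n 2" "V_mat n x \<in> carrier_mat n 2"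
      by (simp_all add: U_mat_def V_mat_def)
    then have A: "U_mat n x * transpose_mat (V_mat n x) \<in> carrier_mat n n" by simp
    show ?thesis
      unfolding permanent_submatrix[OF A assms]
    proof (rule sum.cong[OF refl], rule prod.cong[OF refl])
      fix \<sigma> i assume \<sigma>: "\<sigma> \<in> {\<sigma>. \<sigma> permutes {0..<m}}" and i: "i \<in> {0..<m}"
      then have "\<sigma> i \<in> {0..<m}"
        using permutes_in_image[of \<sigma> "{0..<m}" i] by blast
      with i have "pick I i < n" "pick J (\<sigma> i) < n"
        using pick by simp_all
      then show "(U_mat n x * transpose_mat (V_mat n x)) $$ (pick I i, pick J (\<sigma> i)) = ?a x (pick I i) (pick J (\<sigma> i))"
        using mult_transpose_index[OF UV] by (simp add: dot_def row_vec_def U_mat_def V_mat_def)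
    qed
  qed
  moreover have "homogeneous_fun (entries n) (card {0..<m} * 2)
      (\<lambda>x. \<Sum>\<sigma> | \<sigma> permutes {0..<m}. \<Prod>i\<in>{0..<m}. ?a x (pick I i) (pick J (\<sigma> i)))"
  proof (rule homogeneous_fun_sum, rule homogeneous_fun_prod)
    fix \<sigma> i assume \<sigma>: "\<sigma> \<in> {\<sigma>. \<sigma> permutes {0..<m}}" and i: "i \<in> {0..<m}"
    then have "\<sigma> i \<in> {0..<m}"
      using permutes_in_image[of \<sigma> "{0..<m}" i] by blast
    with i show "homogeneous_fun (entries n) 2 (\<lambda>x. ?a x (pick I i) (pick J (\<sigma> i)))"
      using pick by (intro entry) simp_all
  qed simp
  ultimately show ?thesis
    by (simp add: mult.commute)
qed

lemma homogeneous_fun_pair_det: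
  assumes "i < n" "j < n"
  shows "homogeneous_fun (entries n) 2 (\<lambda>x. pair_det (U_mat n x) i j)"
    and "homogeneous_fun (entries n) 2 (\<lambda>x. pair_det (V_mat n x) i j)"
proof -
  have "pair_det (U_mat n x) i j = x (U_entry i 0) * x (U_entry j 1) - x (U_entry i 1) * x (U_entry j 0)"
    "pair_det (V_mat n x) i j = x (V_entry i 0) * x (V_entry j 1) - x (V_entry i 1) * x (V_entry j 0)" for x
    using assms by (simp_all add: pair_det_eq U_mat_def V_mat_def row_def)
  moreover have "homogeneous_fun (entries n) 2
      (\<lambda>x. x (U_entry i 0) * x (U_entry j 1) - x (U_entry i 1) * x (U_entry j 0))"
    "homogeneous_fun (entries n) 2
      (\<lambda>x. x (V_entry i 0) * x (V_entry j 1) - x (V_entry i 1) * x (V_entry j 0))"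
    by (intro homogeneous_fun_diff homogeneous_fun_mult_vars; use assms in \<open>simp add: entries_def\<close>)+
  ultimately show "homogeneous_fun (entries n) 2 (\<lambda>x. pair_det (U_mat n x) i j)"
    "homogeneous_fun (entries n) 2 (\<lambda>x. pair_det (V_mat n x) i j)"
    by simp_all
qed

lemma perfect_matching_edge_bounds:
  assumes "M \<in> perfect_matchings C" "C \<subseteq> {0..<n}" "e \<in> M"
  shows "Min e < n" "Max e < n"
proof -
  have "e \<subseteq> {0..<n}" "card e = 2"
    using perfect_matchings_remove[OF assms(1,3)] assms(2) by auto
  then have "Min e \<in> e" "Max e \<in> e"
    by (auto intro!: Min_in Max_in simp: card_ge_0_finite)
  with \<open>e \<subseteq> {0..<n}\<close> show "Min e < n" "Max e < n"
    by auto
qed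

lemma homogeneous_fun_matching_product:
  assumes "M \<in> perfect_matchings C" "C \<subseteq> {0..<n}" "card C = 2 * k"
  shows "homogeneous_fun (entries n) (2 * k) (\<lambda>x. \<Prod>e\<in>M. pair_det (U_mat n x) (Min e) (Max e))"
    and "homogeneous_fun (entries n) (2 * k) (\<lambda>x. \<Prod>e\<in>M. pair_det (V_mat n x) (Min e) (Max e))"
proof -
  have fin: "finite C"
    using assms(2) finite_subset by blast
  then have M: "finite M" "card M = k"
    using card_perfect_matching[OF _ assms(1)] assms(3) by auto
  have "homogeneous_fun (entries n) (card M * 2) (\<lambda>x. \<Prod>e\<in>M. pair_det (U_mat n x) (Min e) (Max e))"
    "homogeneous_fun (entries n) (card M * 2) (\<lambda>x. \<Prod>e\<in>M. pair_det (V_mat n x) (Min e) (Max e))"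
    using perfect_matching_edge_bounds[OF assms(1,2)]
    by (auto intro!: homogeneous_fun_prod homogeneous_fun_pair_det M(1))
  then show "homogeneous_fun (entries n) (2 * k) (\<lambda>x. \<Prod>e\<in>M. pair_det (U_mat n x) (Min e) (Max e))"
    "homogeneous_fun (entries n) (2 * k) (\<lambda>x. \<Prod>e\<in>M. pair_det (V_mat n x) (Min e) (Max e))"
    unfolding M(2) by (simp_all add: mult.commute)
qed

text \<open>Expanding both matching sums makes every term the square of a permanent times two
  products of determinants, and the nonnegative coefficient enters through its square root in
  \<open>r\<close>. The polynomial being squared has degree
  \<open>2 * (n - 2 * k) + 2 * k + 2 * k = 2 * n\<close>.\<close>

lemma sos_fun_summand:
  assumes k: "1 \<le> k" "2 * k \<le> n"
    and I: "I \<subseteq> {0..<n}" "card I = n - 2 * k" and J: "J \<subseteq> {0..<n}" "card J = n - 2 * k"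
  shows "sos_fun (entries n) (4 * n) (\<lambda>x. coeff_C n k *
    ((permanent (submatrix (U_mat n x * transpose_mat (V_mat n x)) I J))\<^sup>2 / (fact (n - 2 * k))\<^sup>2 *
     Delta (U_mat n x) ({0..<n} - I) * Delta (V_mat n x) ({0..<n} - J)))"
proof -
  let ?N = "{0..<n}"
  define P where "P x = permanent (submatrix (U_mat n x * transpose_mat (V_mat n x)) I J)" for x
  define DU where "DU M x = (\<Prod>e\<in>M. pair_det (U_mat n x) (Min e) (Max e))" for M x
  define DV where "DV M x = (\<Prod>e\<in>M. pair_det (V_mat n x) (Min e) (Max e))" for M x
  define r where "r = sqrt (coeff_C n k) / fact (n - 2 * k)"
  have card: "card (?N - I) = 2 * k" "card (?N - J) = 2 * k"
    using I J k finite_subset[OF I(1)] finite_subset[OF J(1)] by (simp_all add: card_Diff_subset)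
  have "coeff_C n k * ((P x)\<^sup>2 / (fact (n - 2 * k))\<^sup>2 * Delta (U_mat n x) (?N - I) * Delta (V_mat n x) (?N - J)) =
    (\<Sum>M\<in>perfect_matchings (?N - I). \<Sum>M'\<in>perfect_matchings (?N - J). (r * (P x * (DU M x * DV M' x)))\<^sup>2)" for x
  proof -
    have "r\<^sup>2 = coeff_C n k / (fact (n - 2 * k))\<^sup>2"
      using coeff_C_nonneg[OF k(1)] by (simp add: r_def power_divide)
    then have "coeff_C n k * ((P x)\<^sup>2 / (fact (n - 2 * k))\<^sup>2 * Delta (U_mat n x) (?N - I) * Delta (V_mat n x) (?N - J)) =
      r\<^sup>2 * (P x)\<^sup>2 * (Delta (U_mat n x) (?N - I) * Delta (V_mat n x) (?N - J))"
      by simp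
    also have "\<dots> = (\<Sum>M\<in>perfect_matchings (?N - I). \<Sum>M'\<in>perfect_matchings (?N - J). (r * (P x * (DU M x * DV M' x)))\<^sup>2)"
    proof -
      have "Delta (U_mat n x) (?N - I) * Delta (V_mat n x) (?N - J) =
        (\<Sum>M\<in>perfect_matchings (?N - I). \<Sum>M'\<in>perfect_matchings (?N - J). (DU M x)\<^sup>2 * (DV M' x)\<^sup>2)"
        unfolding Delta_def edge_weight_def DU_def DV_def prod_power_distrib by (rule sum_product)
      then show ?thesis
        by (simp add: sum_distrib_left power_mult_distrib mult.assoc)
    qed
    finally show ?thesis .
  qed
  moreover have "sos_fun (entries n) (4 * n) (\<lambda>x. \<Sum>M\<in>perfect_matchings (?N - I).
      \<Sum>M'\<in>perfect_matchings (?N - J). (r * (P x * (DU M x * DV M' x)))\<^sup>2)"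
  proof (intro sos_fun_sum)
    fix M M' assume M: "M \<in> perfect_matchings (?N - I)" and M': "M' \<in> perfect_matchings (?N - J)"
    have "homogeneous_fun (entries n) (2 * (n - 2 * k) + (2 * k + 2 * k)) (\<lambda>x. P x * (DU M x * DV M' x))"
      unfolding P_def DU_def DV_def
      by (intro homogeneous_fun_mult homogeneous_fun_permanent homogeneous_fun_matching_product[OF M _ card(1)]
          homogeneous_fun_matching_product[OF M' _ card(2)] I J) auto
    moreover have "2 * (n - 2 * k) + (2 * k + 2 * k) = 2 * n"
      using k by simp
    ultimately have "sos_fun (entries n) (2 * (2 * n)) (\<lambda>x. (r * (P x * (DU M x * DV M' x)))\<^sup>2)"
      by (intro sos_fun_square homogeneous_fun_cmult) simp
    then show "sos_fun (entries n) (4 * n) (\<lambda>x. (r * (P x * (DU M x * DV M' x)))\<^sup>2)"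
      by simp
  qed
  ultimately show ?thesis
    by (simp add: P_def)
qed

theorem theorem3p3:
  fixes n :: nat
  shows
    "(\<forall>U V A :: real mat.
        U \<in> carrier_mat n 2 \<longrightarrow> V \<in> carrier_mat n 2 \<longrightarrow> A = U * transpose_mat V \<longrightarrow>
        (permanent A)\<^sup>2 / (fact n)\<^sup>2 - permanent (kronecker A (all_ones_mat 2)) / fact (2 * n) =
        (\<Sum>k = 1..n div 2. coeff_C n k *
           (\<Sum>(I, J) | I \<subseteq> {0..<n} \<and> J \<subseteq> {0..<n} \<and> card I = n - 2 * k \<and> card J = n - 2 * k.
              (permanent (submatrix A I J))\<^sup>2 / (fact (n - 2 * k))\<^sup>2 *
              Delta U ({0..<n} - I) * Delta V ({0..<n} - J)))) \<and>
     (\<forall>k\<in>{1..n div 2}. coeff_C n k \<ge> 0) \<and>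
     (\<exists>p :: entry mpoly.
        mpoly_vars p \<subseteq> entries n \<and> sum_of_squares (entries n) p \<and> homogeneous (4 * n) p \<and>
        (\<forall>U V A :: real mat.
           U \<in> carrier_mat n 2 \<longrightarrow> V \<in> carrier_mat n 2 \<longrightarrow> A = U * transpose_mat V \<longrightarrow>
           (permanent A)\<^sup>2 / (fact n)\<^sup>2 - permanent (kronecker A (all_ones_mat 2)) / fact (2 * n) =
           mpoly_eval (entry_value U V) p))"
proof (intro conjI allI impI)
  fix U V A :: "real mat"
  assume "U \<in> carrier_mat n 2" "V \<in> carrier_mat n 2" "A = U * transpose_mat V"
  then show "(permanent A)\<^sup>2 / (fact n)\<^sup>2 - permanent (kronecker A (all_ones_mat 2)) / fact (2 * n) =
        (\<Sum>k = 1..n div 2. coeff_C n k *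
           (\<Sum>(I, J) | I \<subseteq> {0..<n} \<and> J \<subseteq> {0..<n} \<and> card I = n - 2 * k \<and> card J = n - 2 * k.
              (permanent (submatrix A I J))\<^sup>2 / (fact (n - 2 * k))\<^sup>2 *
              Delta U ({0..<n} - I) * Delta V ({0..<n} - J)))"
    by (rule permanent_difference_eq)
next
  show "\<forall>k\<in>{1..n div 2}. coeff_C n k \<ge> 0"
    by (simp add: coeff_C_nonneg)
next
  \<comment> \<open>Taking the pair as one argument lets \<open>sos_fun_sum\<close> handle the sum
    over all pairs at once.\<close>
  define S where "S k x = (\<lambda>(I, J). coeff_C n k *
    ((permanent (submatrix (U_mat n x * transpose_mat (V_mat n x)) I J))\<^sup>2 / (fact (n - 2 * k))\<^sup>2 *
     Delta (U_mat n x) ({0..<n} - I) * Delta (V_mat n x) ({0..<n} - J)))" for k x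
  let ?X = "\<lambda>k. {(I, J). I \<subseteq> {0..<n} \<and> J \<subseteq> {0..<n} \<and> card I = n - 2 * k \<and> card J = n - 2 * k}"
  have "sos_fun (entries n) (4 * n) (\<lambda>x. \<Sum>k = 1..n div 2. \<Sum>IJ\<in>?X k. S k x IJ)"
  proof (intro sos_fun_sum)
    fix k IJ assume k: "k \<in> {1..n div 2}" and IJ: "IJ \<in> ?X k"
    obtain I J where "IJ = (I, J)" by (cases IJ)
    with k IJ show "sos_fun (entries n) (4 * n) (\<lambda>x. S k x IJ)"
      unfolding S_def by (simp only: prod.case) (rule sos_fun_summand; auto)
  qed
  then obtain p where p: "mpoly_vars p \<subseteq> entries n" "sum_of_squares (entries n) p" "homogeneous (4 * n) p"
    and eval: "\<And>x. mpoly_eval x p = (\<Sum>k = 1..n div 2. \<Sum>IJ\<in>?X k. S k x IJ)"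
    unfolding sos_fun_def by blast
  have "(permanent A)\<^sup>2 / (fact n)\<^sup>2 - permanent (kronecker A (all_ones_mat 2)) / fact (2 * n) =
      mpoly_eval (entry_value U V) p"
    if UV: "U \<in> carrier_mat n 2" "V \<in> carrier_mat n 2" "A = U * transpose_mat V" for U V A :: "real mat"
  proof -
    have mats: "U_mat n (entry_value U V) = U" "V_mat n (entry_value U V) = V"
      using UV by (auto simp: U_mat_def V_mat_def entry_value_def intro!: eq_matI)
    show ?thesis
      unfolding permanent_difference_eq[OF UV] eval S_def mats UV(3)[symmetric]
      by (simp add: sum_distrib_left case_prod_unfold)
  qed
  with p show "\<exists>p :: entry mpoly.
        mpoly_vars p \<subseteq> entries n \<and> sum_of_squares (entries n) p \<and> homogeneous (4 * n) p \<and>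
        (\<forall>U V A :: real mat.
           U \<in> carrier_mat n 2 \<longrightarrow> V \<in> carrier_mat n 2 \<longrightarrow> A = U * transpose_mat V \<longrightarrow>
           (permanent A)\<^sup>2 / (fact n)\<^sup>2 - permanent (kronecker A (all_ones_mat 2)) / fact (2 * n) =
           mpoly_eval (entry_value U V) p)"
    by blast
qed

end
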